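(* Suppose that $G$ is a separable topological group, $X$ is a Polish space, $G \curvearrowright X$ is a continuous action, and $\mathcal{S}$ is the family of sets of the form $S^{-1}S \setminus \{1_G\}$, where $S \subseteq G$ is infinite. Then the following are equivalent: (1) There exists $S \in \mathcal{S}$ for which the family $\mathcal{F}_S$ is not in the recurrence spectrum of $G \curvearrowright X$. (2) There exist an infinite set $S \subseteq G$ and a smooth $\aleph_0$-universally-Baire superequivalence relation $F$ of $E_G^X$ such that for every $x \in X$, the action $G \curvearrowright [x]_F$ has an $S$-wandering $\sigma$-complete $\aleph_0$-universally-Baire set. (3) The action $G \curvearrowright X$ has a weakly wandering $\sigma$-complete $\mathbf{\Sigma}^0_2$ set.
   Context: $E_G^X$ is the orbit equivalence relation of $G \curvearrowright X$. A superequivalence relation of an equivalence relation $E$ is an equivalence relation containing $E$; each class $C$ of a superequivalence relation of $E_G^X$ is $G$-invariant, so $G$ acts on $C$. $[x]_F$ is the $F$-class of $x$. For an action $G \curvearrowright Z$, a set $Y \subseteq Z$ is $\sigma$-complete if there is a countable set $H \subseteq G$ with $Z = HY$; it is $S$-wandering (for $S \subseteq G$) if $gY \cap hY = \emptyset$ for all distinct $g,h \in S$; it is weakly wandering if it is $S$-wandering for some infinite $S \subseteq G$. Let $\Delta(Y) = \{g \in G \mid Y \cap gY \neq \emptyset\}$. For $S \subseteq G$, $\mathcal{F}_S = \{T \subseteq G \mid S \cap T \neq \emptyset\}$. A subset of a Borel (or topological) space $Z$ is $\aleph_0$-universally Baire if its preimage under every Borel function from a Polish space to $Z$ has the Baire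 property. An $\aleph_0$-universally-Baire equivalence relation $E$ on $Z$ (i.e., $E$ is an $\aleph_0$-universally-Baire subset of $Z \times Z$) is smooth if there is no Borel function $\pi \colon 2^{\mathbb{N}} \to Z$ such that $c \mathrel{\mathbb{E}_0} d \iff \pi(c) \mathrel{E} \pi(d)$ for all $c,d \in 2^{\mathbb{N}}$, where $c \mathrel{\mathbb{E}_0} d \iff \exists n\, \forall m \ge n\ c(m) = d(m)$. For Borel equivalence relations on standard Borel spaces this agrees with the usual notion: there is a Borel $\pi$ into a standard Borel space with $x \mathrel{E} y \iff \pi(x)=\pi(y)$. For an upward-closed family $\mathcal{F} \subseteq \mathcal{P}(G)$ and $\Gamma \subseteq \mathcal{P}(Z)$, the action $G \curvearrowright Z$ is $\mathcal{F}$-recurrent on $\Gamma$ if $\Delta(B) \in \mathcal{F}$ for all $B \in \Gamma$. The recurrence spectrum of $G \curvearrowright X$ is the collection of all upward-closed families $\mathcal{F} \subseteq \mathcal{P}(G)$ such that every smooth Borel superequivalence relation $F$ of $E_G^X$ has an equivalence class $C$ for which $G \curvearrowright C$ is $\mathcal{F}$-recurrent on $\sigma$-complete Borel sets. $\mathbf{\Sigma}^0_2$ sets are countable unions of closed sets. *)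

theory Defs
  imports "HOL-Analysis.Analysis" "HOL-Algebra.Group_Action"
begin

section \<open>Polish spaces, Borel sets and the Baire property\<close>

definition polish_topology :: "'a topology \<Rightarrow> bool" where
  "polish_topology X \<longleftrightarrow> completely_metrizable_space X \<and> separable_space X"

definition borel_of :: "'a topology \<Rightarrow> 'a measure" where
  "borel_of X = sigma (topspace X) {U. openin X U}"

lemma space_borel_of [simp]: "space (borel_of X) = topspace X"
  unfolding borel_of_def by (rule space_measure_of) (auto dest: openin_subset)

lemma sets_borel_of: "sets (borel_of X) = sigma_sets (topspace X) {U. openin X U}"
  unfolding borel_of_def by (rule sets_measure_of) (auto dest: openin_subset)

definition nowhere_dense_in :: "'a topology \<Rightarrow> 'a set \<Rightarrow> bool" where
  "nowhere_dense_in X A \<longleftrightarrow> A \<subseteq> topspace X \<and> X interior_of (X closure_of A) = {}"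

definition meagre_in :: "'a topology \<Rightarrow> 'a set \<Rightarrow> bool" where
  "meagre_in X = countable union_of nowhere_dense_in X"

definition baire_property_in :: "'a topology \<Rightarrow> 'a set \<Rightarrow> bool" where
  "baire_property_in X A \<longleftrightarrow>
     A \<subseteq> topspace X \<and> (\<exists>U. openin X U \<and> meagre_in X (sym_diff A U))"

text \<open>A definition cannot quantify over all types, so the Polish spaces range over the Polish
  topologies whose underlying set is an arbitrary subset of the type \<open>nat \<Rightarrow> bool\<close> (the topology
  itself is arbitrary and need not be related to the one of the Cantor space). Every Polish space
  has at most continuum many points, hence is homeomorphic to one of these; the lemma
  \<open>universally_baire_in_preimage\<close> below removes the restriction.\<close>

definition universally_baire_in :: "'a topology \<Rightarrow> 'a set \<Rightarrow> bool" where
  "universally_baire_in Z A \<longleftrightarrow>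
     A \<subseteq> topspace Z \<and>
     (\<forall>P :: (nat \<Rightarrow> bool) topology. polish_topology P \<longrightarrow>
        (\<forall>f \<in> measurable (borel_of P) (borel_of Z).
           baire_property_in P (f -` A \<inter> topspace P)))"

lemma polish_inj_cantor:
  assumes "polish_topology P"
  obtains e :: "'p \<Rightarrow> nat \<Rightarrow> bool" where "inj_on e (topspace P)"
proof -
  obtain M d where M: "Metric_space M d" and P: "P = Metric_space.mtopology M d"
    using assms by (auto simp: polish_topology_def completely_metrizable_space_def)
  interpret Metric_space M d by (rule M)
  obtain D where D: "countable D" "D \<subseteq> M" "mtopology closure_of D = M"
    using assms P by (auto simp: polish_topology_def separable_space_def)
  define e where "e x n = (case prod_decode n of (i, k) \<Rightarrow>
      x \<in> mball (from_nat_into D i) (1 / Suc k))" for x n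
  have "inj_on e M"
  proof (rule inj_onI, rule ccontr)
    fix x y assume xy: "x \<in> M" "y \<in> M" "e x = e y" "x \<noteq> y"
    then have "d x y / 2 > 0" by simp
    then obtain k where k: "1 / real (Suc k) < d x y / 2"
      by (rule nat_approx_posE)
    have "x \<in> mtopology closure_of D" using D xy by simp
    then have "\<forall>r>0. \<exists>a\<in>D. a \<in> mball x r" unfolding metric_closure_of by blast
    moreover have "1 / real (Suc k) > 0" by simp
    ultimately obtain a where a: "a \<in> D" "a \<in> mball x (1 / Suc k)" by blast
    then obtain i where i: "a = from_nat_into D i"
      using from_nat_into_surj[OF D(1) a(1)] by blast
    have xa: "x \<in> mball a (1 / Suc k)"
      using a(2) by (simp add: commute)
    have "e x (prod_encode (i, k))" using xa i by (simp add: e_def)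
    then have "e y (prod_encode (i, k))" using xy(3) by simp
    then have ya: "y \<in> mball a (1 / Suc k)" using i by (simp add: e_def)
    have "d x y \<le> d x a + d a y"
      using xa xy by (intro triangle) auto
    also have "\<dots> < 1 / Suc k + 1 / Suc k"
      using xa ya by (auto simp: commute)
    finally show False using k by simp
  qed
  then show ?thesis using that P by simp
qed

lemma homeomorphic_map_nowhere_dense_in:
  assumes "homeomorphic_map X Y h" "nowhere_dense_in X A"
  shows "nowhere_dense_in Y (h ` A)"
proof -
  have A: "A \<subseteq> topspace X" using assms(2) by (simp add: nowhere_dense_in_def)
  have "Y interior_of (Y closure_of (h ` A)) = h ` (X interior_of (X closure_of A))"
    using homeomorphic_map_closure_of[OF assms(1) A]
      homeomorphic_map_interior_of[OF assms(1), of "X closure_of A"]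
    by (simp add: closure_of_subset_topspace)
  moreover have "h ` A \<subseteq> topspace Y"
    using A homeomorphic_imp_surjective_map[OF assms(1)] by blast
  ultimately show ?thesis using assms(2) by (simp add: nowhere_dense_in_def)
qed

lemma homeomorphic_map_baire_property_in:
  assumes h: "homeomorphic_map X Y h" and "baire_property_in X A"
  shows "baire_property_in Y (h ` A)"
proof -
  obtain U \<N> where A: "A \<subseteq> topspace X" and U: "openin X U"
    and N: "countable \<N>" "\<N> \<subseteq> Collect (nowhere_dense_in X)" "\<Union>\<N> = sym_diff A U"
    using assms(2) by (auto simp: baire_property_in_def meagre_in_def union_of_def)
  have US: "U \<subseteq> topspace X" using U by (rule openin_subset)
  have inj: "inj_on h (topspace X)" using h by (rule homeomorphic_imp_injective_map)
  have "sym_diff (h ` A) (h ` U) = h ` sym_diff A U"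
    using inj_on_image_set_diff[OF inj _ US, of A] inj_on_image_set_diff[OF inj _ A, of U] A US
    by (simp add: image_Un Diff_subset[THEN order_trans])
  also have "\<dots> = \<Union> ((`) h ` \<N>)" by (simp only: N(3)[symmetric] image_Union)
  finally have "\<Union> ((`) h ` \<N>) = sym_diff (h ` A) (h ` U)" by simp
  moreover have "(`) h ` \<N> \<subseteq> Collect (nowhere_dense_in Y)"
    using N(2) homeomorphic_map_nowhere_dense_in[OF h] by auto
  moreover have "countable ((`) h ` \<N>)" using N(1) by simp
  ultimately have "meagre_in Y (sym_diff (h ` A) (h ` U))"
    unfolding meagre_in_def union_of_def by blast
  moreover have "openin Y (h ` U)" using homeomorphic_map_openness[OF h US] U by simp
  moreover have "h ` A \<subseteq> topspace Y" using A homeomorphic_imp_surjective_map[OF h] by blast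
  ultimately show ?thesis unfolding baire_property_in_def by blast
qed

lemma continuous_map_borel_of:
  assumes "continuous_map X Y f"
  shows "f \<in> measurable (borel_of X) (borel_of Y)"
  unfolding borel_of_def[of Y]
proof (rule measurable_measure_of)
  show "{U. openin Y U} \<subseteq> Pow (topspace Y)" by (auto dest: openin_subset)
  show "f \<in> space (borel_of X) \<rightarrow> topspace Y"
    using assms by (auto simp: continuous_map_def)
  fix U assume "U \<in> {U. openin Y U}"
  then have "openin X {x \<in> topspace X. f x \<in> U}"
    using assms by (simp add: continuous_map_def)
  moreover have "{x \<in> topspace X. f x \<in> U} = f -` U \<inter> topspace X" by auto
  ultimately show "f -` U \<inter> space (borel_of X) \<in> sets (borel_of X)"
    by (simp add: sets_borel_of sigma_sets.Basic)
qed

lemma universally_baire_in_preimage: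
  fixes P :: "'p topology"
  assumes A: "universally_baire_in Z A" and P: "polish_topology P"
    and f: "f \<in> measurable (borel_of P) (borel_of Z)"
  shows "baire_property_in P (f -` A \<inter> topspace P)"
proof -
  obtain e :: "'p \<Rightarrow> nat \<Rightarrow> bool" where e: "inj_on e (topspace P)"
    using P by (rule polish_inj_cantor)
  define g where "g = inv_into (topspace P) e"
  define Q where "Q = pullback_topology (e ` topspace P) g P"
  have ge: "g (e x) = x" if "x \<in> topspace P" for x
    using e that by (simp add: g_def)
  have Q: "topspace Q = e ` topspace P"
    unfolding Q_def topspace_pullback_topology using ge by auto
  have "continuous_map Q P g"
    using continuous_map_pullback[OF continuous_map_id, of "e ` topspace P" g P]
    unfolding Q_def id_comp .
  moreover have "continuous_map P Q e"
    unfolding Q_def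
  proof (rule continuous_map_pullback')
    show "continuous_map P P (g \<circ> e)"
      by (rule continuous_map_eq[OF continuous_map_id]) (simp add: ge)
  qed auto
  ultimately have hm: "homeomorphic_maps Q P g e"
    using Q ge by (auto simp: homeomorphic_maps_def)
  then have g: "homeomorphic_map Q P g" and hs: "Q homeomorphic_space P"
    by (auto simp: homeomorphic_maps_map homeomorphic_space_def)
  have "polish_topology Q"
    using P homeomorphic_completely_metrizable_space[OF hs] homeomorphic_separable_space[OF hs]
    by (simp add: polish_topology_def)
  moreover have "f \<circ> g \<in> measurable (borel_of Q) (borel_of Z)"
    using continuous_map_borel_of[OF \<open>continuous_map Q P g\<close>] f by (rule measurable_comp)
  ultimately have "baire_property_in Q ((f \<circ> g) -` A \<inter> topspace Q)"
    using A by (simp add: universally_baire_in_def)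
  from homeomorphic_map_baire_property_in[OF g this]
  have "baire_property_in P (g ` ((f \<circ> g) -` A \<inter> topspace Q))" .
  moreover have "g ` ((f \<circ> g) -` A \<inter> topspace Q) = f -` A \<inter> topspace P"
  proof -
    have "g ` {e x | x. x \<in> B} = B" if "B \<subseteq> topspace P" for B
      using ge that by (auto simp: subset_iff image_def)
    moreover have "(f \<circ> g) -` A \<inter> topspace Q = {e x | x. x \<in> f -` A \<inter> topspace P}"
      unfolding Q using ge by auto
    ultimately show ?thesis by (simp only: Int_lower2)
  qed
  ultimately show ?thesis by simp
qed


section \<open>Smooth equivalence relations\<close>

definition cantor_space :: "(nat \<Rightarrow> bool) topology" where
  "cantor_space = product_topology (\<lambda>_. discrete_topology UNIV) UNIV"

definition E0 :: "((nat \<Rightarrow> bool) \<times> (nat \<Rightarrow> bool)) set" where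
  "E0 = {(c, d). \<exists>n. \<forall>m\<ge>n. c m = d m}"

text \<open>The notion is meant for universally Baire equivalence relations; that requirement is stated
  separately where smoothness is used.\<close>

definition smooth_equiv :: "'a topology \<Rightarrow> ('a \<times> 'a) set \<Rightarrow> bool" where
  "smooth_equiv Z E \<longleftrightarrow>
     \<not> (\<exists>\<pi> \<in> measurable (borel_of cantor_space) (borel_of Z).
          \<forall>c d. (c, d) \<in> E0 \<longleftrightarrow> (\<pi> c, \<pi> d) \<in> E)"

definition superequivalence :: "'a set \<Rightarrow> ('a \<times> 'a) set \<Rightarrow> ('a \<times> 'a) set \<Rightarrow> bool" where
  "superequivalence A E F \<longleftrightarrow> equiv A F \<and> E \<subseteq> F"


section \<open>Topological groups and continuous actions\<close>

definition topological_group :: "('g, 'm) monoid_scheme \<Rightarrow> 'g topology \<Rightarrow> bool" where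
  "topological_group G T \<longleftrightarrow>
     group G \<and> topspace T = carrier G \<and>
     continuous_map (prod_topology T T) T (\<lambda>(g, h). g \<otimes>\<^bsub>G\<^esub> h) \<and>
     continuous_map T T (\<lambda>g. inv\<^bsub>G\<^esub> g)"

definition continuous_action ::
    "('g, 'm) monoid_scheme \<Rightarrow> 'g topology \<Rightarrow> 'x topology \<Rightarrow> ('g \<Rightarrow> 'x \<Rightarrow> 'x) \<Rightarrow> bool" where
  "continuous_action G T X \<phi> \<longleftrightarrow>
     group_action G (topspace X) \<phi> \<and>
     continuous_map (prod_topology T X) X (\<lambda>(g, x). \<phi> g x)"

definition orbit_equiv ::
    "('g, 'm) monoid_scheme \<Rightarrow> 'x set \<Rightarrow> ('g \<Rightarrow> 'x \<Rightarrow> 'x) \<Rightarrow> ('x \<times> 'x) set" where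
  "orbit_equiv G A \<phi> = {(x, y). x \<in> A \<and> y \<in> orbit G \<phi> x}"


section \<open>Wandering and recurrence\<close>

text \<open>These notions are applied to the action of \<open>G\<close> on an invariant set \<open>Z\<close>. They involve \<open>\<phi>\<close> only
  through images of subsets of \<open>Z\<close>, so \<open>\<phi>\<close> is not restricted to \<open>Z\<close>.\<close>

definition sigma_complete ::
    "('g, 'm) monoid_scheme \<Rightarrow> 'x set \<Rightarrow> ('g \<Rightarrow> 'x \<Rightarrow> 'x) \<Rightarrow> 'x set \<Rightarrow> bool" where
  "sigma_complete G Z \<phi> Y \<longleftrightarrow>
     Y \<subseteq> Z \<and> (\<exists>H \<subseteq> carrier G. countable H \<and> Z = (\<Union>h\<in>H. \<phi> h ` Y))"

definition wandering :: "('g \<Rightarrow> 'x \<Rightarrow> 'x) \<Rightarrow> 'g set \<Rightarrow> 'x set \<Rightarrow> bool" where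
  "wandering \<phi> S Y \<longleftrightarrow> (\<forall>g\<in>S. \<forall>h\<in>S. g \<noteq> h \<longrightarrow> \<phi> g ` Y \<inter> \<phi> h ` Y = {})"

definition weakly_wandering ::
    "('g, 'm) monoid_scheme \<Rightarrow> ('g \<Rightarrow> 'x \<Rightarrow> 'x) \<Rightarrow> 'x set \<Rightarrow> bool" where
  "weakly_wandering G \<phi> Y \<longleftrightarrow> (\<exists>S \<subseteq> carrier G. infinite S \<and> wandering \<phi> S Y)"

definition return_set ::
    "('g, 'm) monoid_scheme \<Rightarrow> ('g \<Rightarrow> 'x \<Rightarrow> 'x) \<Rightarrow> 'x set \<Rightarrow> 'g set" where
  "return_set G \<phi> Y = {g \<in> carrier G. Y \<inter> \<phi> g ` Y \<noteq> {}}"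

definition meeting_family :: "('g, 'm) monoid_scheme \<Rightarrow> 'g set \<Rightarrow> 'g set set" where
  "meeting_family G S = {T. T \<subseteq> carrier G \<and> S \<inter> T \<noteq> {}}"

definition upward_closed_family :: "('g, 'm) monoid_scheme \<Rightarrow> 'g set set \<Rightarrow> bool" where
  "upward_closed_family G \<F> \<longleftrightarrow>
     \<F> \<subseteq> Pow (carrier G) \<and> (\<forall>A\<in>\<F>. \<forall>B. A \<subseteq> B \<and> B \<subseteq> carrier G \<longrightarrow> B \<in> \<F>)"

definition recurrent_on ::
    "('g, 'm) monoid_scheme \<Rightarrow> ('g \<Rightarrow> 'x \<Rightarrow> 'x) \<Rightarrow> 'g set set \<Rightarrow> 'x set set \<Rightarrow> bool" where
  "recurrent_on G \<phi> \<F> \<Gamma> \<longleftrightarrow> (\<forall>B\<in>\<Gamma>. return_set G \<phi> B \<in> \<F>)"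

definition recurrence_spectrum ::
    "('g, 'm) monoid_scheme \<Rightarrow> 'x topology \<Rightarrow> ('g \<Rightarrow> 'x \<Rightarrow> 'x) \<Rightarrow> 'g set set set" where
  "recurrence_spectrum G X \<phi> =
     {\<F>. upward_closed_family G \<F> \<and>
        (\<forall>F. superequivalence (topspace X) (orbit_equiv G (topspace X) \<phi>) F \<and>
             F \<in> sets (borel_of (prod_topology X X)) \<and> smooth_equiv X F \<longrightarrow>
           (\<exists>C \<in> topspace X // F.
              recurrent_on G \<phi> \<F>
                {B \<in> sets (borel_of (subtopology X C)). sigma_complete G C \<phi> B}))}"

definition quotient_sets :: "('g, 'm) monoid_scheme \<Rightarrow> 'g set set" where
  "quotient_sets G =
     {((set_inv\<^bsub>G\<^esub> S) <#>\<^bsub>G\<^esub> S) - {\<one>\<^bsub>G\<^esub>} | S. S \<subseteq> carrier G \<and> infinite S}"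

end

theory Submission
  imports Defs
begin

text \<open>
  Membership of \<open>\<F>\<^sub>Q\<close> in the recurrence spectrum, for \<open>Q = S\<^sup>-\<^sup>1S - {1}\<close>, fails exactly when some smooth
  Borel relation has, in each of its classes, an \<open>S\<close>-wandering \<open>\<sigma>\<close>-complete Borel set
  (\<open>not_in_recurrence_spectrum_iff\<close>). As Borel sets are universally Baire, this gives the classwise
  condition; and an \<open>F\<^sub>\<sigma>\<close> weakly wandering \<open>\<sigma>\<close>-complete set makes recurrence fail for the
  coarsest relation. The content lies in passing from universally Baire sets chosen
  separately in each class to one \<open>F\<^sub>\<sigma>\<close> set, for the same \<open>S\<close>.

  The passage is by Baire category on the closure \<open>Z\<close> of an orbit \<open>Gx\<close>, where one orbit is dense.
  Suppose all classes of \<open>F\<close> were meagre in \<open>Z\<close>. By the Kuratowski--Ulam theorem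
  (\<open>meagre_in_prod_of_sections\<close>), \<open>F\<close> would be meagre in \<open>Z \<times> Z\<close>; since \<open>F\<close> contains the orbit
  relation, a Cantor scheme of translates of small open sets would then embed \<open>E0\<close> into \<open>F\<close>
  (\<open>E0_embeds_in_meagre\<close>), against smoothness. So some class is not meagre in \<open>Z\<close>. Countably many
  translates of its wandering set cover it, so the wandering set is not meagre either and, having
  the Baire property, is almost all of some nonempty open \<open>W \<subseteq> Z\<close>. Two translates of \<open>W\<close> along \<open>S\<close>
  meet in an open set that is meagre, hence empty: \<open>W\<close> is itself wandering. Thus for every \<open>x\<close>
  there is an open set \<open>U\<close> that meets \<open>Gx\<close> and for which \<open>U \<inter> Gx\<close> is \<open>S\<close>-wandering
  (\<open>locally_wandering_open_set\<close>).

  The relation \<open>F\<close> no longer occurs in this conclusion. For fixed \<open>U\<close> the points \<open>x\<close> with this property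
  form an invariant difference of two open sets, and countably many basic \<open>U\<close> serve all points.
  Splitting the space accordingly into invariant pieces and intersecting each piece with its basic
  open set gives an \<open>S\<close>-wandering \<open>F\<^sub>\<sigma>\<close> set that contains a nonempty relatively open part of every
  orbit (\<open>fsigma_weakly_wandering\<close>). A countable dense set of group elements then moves that set
  over the whole space.
\<close>

section \<open>Meagre sets and the Baire property\<close>

lemma meagre_in_iff:
  "meagre_in X A \<longleftrightarrow> (\<exists>\<N>. countable \<N> \<and> (\<forall>N\<in>\<N>. nowhere_dense_in X N) \<and> A = \<Union>\<N>)"
  unfolding meagre_in_def union_of_def by blast

lemma nowhere_dense_in_subset:
  assumes "nowhere_dense_in X A" "B \<subseteq> A"
  shows "nowhere_dense_in X B"
  using assms interior_of_mono[OF closure_of_mono[OF assms(2)], of X]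
  unfolding nowhere_dense_in_def by blast

lemma nowhere_dense_imp_meagre_in: "nowhere_dense_in X A \<Longrightarrow> meagre_in X A"
  unfolding meagre_in_iff by (rule exI[of _ "{A}"]) auto

lemma meagre_in_subset:
  assumes "meagre_in X A" "B \<subseteq> A"
  shows "meagre_in X B"
proof -
  obtain \<N> where \<N>: "countable \<N>" "\<forall>N\<in>\<N>. nowhere_dense_in X N" "A = \<Union>\<N>"
    using assms(1) unfolding meagre_in_iff by blast
  have "countable ((\<lambda>N. N \<inter> B) ` \<N>)" using \<N>(1) by simp
  moreover have "\<forall>N\<in>(\<lambda>N. N \<inter> B) ` \<N>. nowhere_dense_in X N"
    using \<N>(2) nowhere_dense_in_subset by blast
  moreover have "B = \<Union>((\<lambda>N. N \<inter> B) ` \<N>)" using \<N>(3) assms(2) by blast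
  ultimately show ?thesis unfolding meagre_in_iff by blast
qed

lemma meagre_in_UN:
  assumes "countable I" "\<And>i. i \<in> I \<Longrightarrow> meagre_in X (A i)"
  shows "meagre_in X (\<Union>i\<in>I. A i)"
proof -
  have "\<forall>i\<in>I. \<exists>\<N>. countable \<N> \<and> (\<forall>N\<in>\<N>. nowhere_dense_in X N) \<and> A i = \<Union>\<N>"
    using assms(2) unfolding meagre_in_iff by blast
  then obtain \<N> where \<N>: "\<And>i. i \<in> I \<Longrightarrow> countable (\<N> i)"
      "\<And>i. i \<in> I \<Longrightarrow> \<forall>N\<in>\<N> i. nowhere_dense_in X N" "\<And>i. i \<in> I \<Longrightarrow> A i = \<Union>(\<N> i)"
    by metis
  have "countable (\<Union>i\<in>I. \<N> i)" using assms(1) \<N>(1) by blast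
  moreover have "\<forall>N\<in>(\<Union>i\<in>I. \<N> i). nowhere_dense_in X N" using \<N>(2) by blast
  moreover have "(\<Union>i\<in>I. A i) = \<Union>(\<Union>i\<in>I. \<N> i)" using \<N>(3) by blast
  ultimately show ?thesis unfolding meagre_in_iff by blast
qed

lemma meagre_in_Un:
  assumes "meagre_in X A" "meagre_in X B"
  shows "meagre_in X (A \<union> B)"
  using meagre_in_UN[of "{A, B}" X "\<lambda>A. A"] assms by auto

lemma homeomorphic_map_meagre_in:
  assumes "homeomorphic_map X Y h" "meagre_in X A"
  shows "meagre_in Y (h ` A)"
proof -
  obtain \<N> where \<N>: "countable \<N>" "\<forall>N\<in>\<N>. nowhere_dense_in X N" "A = \<Union>\<N>"
    using assms(2) unfolding meagre_in_iff by blast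
  have "countable ((`) h ` \<N>)" using \<N>(1) by simp
  moreover have "\<forall>N\<in>(`) h ` \<N>. nowhere_dense_in Y N"
    using \<N>(2) homeomorphic_map_nowhere_dense_in[OF assms(1)] by blast
  moreover have "h ` A = \<Union>((`) h ` \<N>)" using \<N>(3) by blast
  ultimately show ?thesis unfolding meagre_in_iff by blast
qed

lemma openin_meagre_in_empty:
  assumes "completely_metrizable_space X" "openin X W" "meagre_in X W"
  shows "W = {}"
proof -
  obtain \<N> where \<N>: "countable \<N>" "\<forall>N\<in>\<N>. nowhere_dense_in X N" "W = \<Union>\<N>"
    using assms(3) unfolding meagre_in_iff by blast
  have "X interior_of \<Union>((closure_of) X ` \<N>) = {}"
    by (rule Baire_category_alt) (use assms(1) \<N> in \<open>auto simp: nowhere_dense_in_def\<close>)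
  moreover have "W \<subseteq> \<Union>((closure_of) X ` \<N>)"
    using \<N> closure_of_subset unfolding nowhere_dense_in_def by fastforce
  ultimately show ?thesis
    using assms(2) unfolding interior_of_eq_empty by blast
qed

lemma baire_property_in_openin: "openin X U \<Longrightarrow> baire_property_in X U"
  unfolding baire_property_in_def
  using openin_subset[of X U] meagre_in_UN[of "{}" X] by (intro conjI exI[of _ U]) auto

text \<open>A closed set differs from its interior by a nowhere dense set, so the complement of an open
  set is almost equal to an open set.\<close>

lemma baire_property_in_Compl:
  assumes "baire_property_in X A"
  shows "baire_property_in X (topspace X - A)"
proof -
  obtain U where A: "A \<subseteq> topspace X" and U: "openin X U" "meagre_in X (sym_diff A U)"
    using assms by (auto simp: baire_property_in_def)
  define C where "C = topspace X - U"
  define V where "V = X interior_of C"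
  have C: "closedin X C" using U by (simp add: C_def closedin_diff)
  have V: "openin X V" "V \<subseteq> C"
    by (auto simp: V_def interior_of_subset)
  have "closedin X (C - V)" using C V by (simp add: closedin_diff)
  moreover have "X interior_of (C - V) = {}"
    unfolding interior_of_eq_empty V_def
    using interior_of_maximal[of _ C X] by blast
  ultimately have "nowhere_dense_in X (C - V)"
    by (simp add: nowhere_dense_in_def closure_of_closedin closedin_subset)
  then have "meagre_in X (sym_diff A U \<union> (C - V))"
    using U(2) meagre_in_Un nowhere_dense_imp_meagre_in by blast
  moreover have "sym_diff (topspace X - A) V \<subseteq> sym_diff A U \<union> (C - V)"
    using V(2) openin_subset[OF U(1)] unfolding C_def by blast
  ultimately have "meagre_in X (sym_diff (topspace X - A) V)"
    by (rule meagre_in_subset)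
  then show ?thesis using V(1) unfolding baire_property_in_def by blast
qed

lemma baire_property_in_UN:
  assumes "\<And>n::nat. baire_property_in X (A n)"
  shows "baire_property_in X (\<Union>n. A n)"
proof -
  obtain U where U: "\<And>n. A n \<subseteq> topspace X" "\<And>n. openin X (U n)"
      "\<And>n. meagre_in X (sym_diff (A n) (U n))"
    using assms unfolding baire_property_in_def by metis
  have "meagre_in X (\<Union>n. sym_diff (A n) (U n))" by (rule meagre_in_UN) (auto intro: U(3))
  then have "meagre_in X (sym_diff (\<Union>n. A n) (\<Union>n. U n))"
    by (rule meagre_in_subset) blast
  moreover have "openin X (\<Union>n. U n)" using U(2) by blast
  moreover have "(\<Union>n. A n) \<subseteq> topspace X" using U(1) by blast
  ultimately show ?thesis unfolding baire_property_in_def by blast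
qed

lemma borel_imp_baire_property_in:
  assumes "A \<in> sets (borel_of X)"
  shows "baire_property_in X A"
proof -
  have "A \<in> sigma_sets (topspace X) {U. openin X U}" using assms by (simp add: sets_borel_of)
  then show ?thesis
  proof induction
    case (Basic a) then show ?case by (simp add: baire_property_in_openin)
  next
    case Empty show ?case by (simp add: baire_property_in_openin)
  next
    case (Compl a) then show ?case by (simp add: baire_property_in_Compl)
  next
    case (Union a) then show ?case by (simp add: baire_property_in_UN)
  qed
qed

lemma openin_borel_of: "openin X U \<Longrightarrow> U \<in> sets (borel_of X)"
  by (simp add: sets_borel_of sigma_sets.Basic)

lemma closedin_borel_of:
  assumes "closedin X C"
  shows "C \<in> sets (borel_of X)"
proof -
  have "topspace X - C \<in> sets (borel_of X)" using assms by (simp add: openin_borel_of openin_diff)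
  then have "space (borel_of X) - (topspace X - C) \<in> sets (borel_of X)" by (rule sets.compl_sets)
  then show ?thesis using closedin_subset[OF assms] by (simp add: double_diff)
qed

lemma fsigma_in_borel_of:
  assumes "fsigma_in X A"
  shows "A \<in> sets (borel_of X)"
proof -
  obtain \<C> where \<C>: "countable \<C>" "\<C> \<subseteq> Collect (closedin X)" "\<Union>\<C> = A"
    using assms by (auto simp: fsigma_in_def union_of_def)
  then have "\<Union>\<C> \<in> sets (borel_of X)"
    by (intro sets.countable_Union) (auto intro: closedin_borel_of)
  then show ?thesis using \<C>(3) by simp
qed

lemma borel_imp_universally_baire_in:
  assumes "A \<in> sets (borel_of Z)"
  shows "universally_baire_in Z A"
  unfolding universally_baire_in_def
proof (intro conjI allI impI ballI)
  show "A \<subseteq> topspace Z" using sets.sets_into_space[OF assms] by simp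
  fix P :: "(nat \<Rightarrow> bool) topology" and f
  assume "f \<in> measurable (borel_of P) (borel_of Z)"
  from measurable_sets[OF this assms] show "baire_property_in P (f -` A \<inter> topspace P)"
    by (simp add: borel_imp_baire_property_in)
qed

lemma polish_second_countable:
  assumes "polish_topology X"
  shows "second_countable X"
proof -
  obtain M d where M: "Metric_space M d" and X: "X = Metric_space.mtopology M d"
    using assms by (auto simp: polish_topology_def completely_metrizable_space_def)
  interpret Metric_space M d by (rule M)
  obtain D where D: "countable D" "D \<subseteq> M" "mtopology closure_of D = M"
    using assms X by (auto simp: polish_topology_def separable_space_def)
  define \<B> where "\<B> = (\<lambda>(a, n). mball a (1 / real (Suc n))) ` (D \<times> UNIV)"
  have "\<exists>V\<in>\<B>. x \<in> V \<and> V \<subseteq> U" if "openin mtopology U" "x \<in> U" for U x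
  proof -
    obtain r where r: "r > 0" "mball x r \<subseteq> U" and x: "x \<in> M"
      using \<open>openin mtopology U\<close> \<open>x \<in> U\<close> unfolding openin_mtopology by blast
    have "r / 2 > 0" using r by simp
    then obtain n where n: "1 / real (Suc n) < r / 2" by (rule nat_approx_posE)
    have "x \<in> mtopology closure_of D" using D x by simp
    then have "\<forall>r>0. \<exists>a\<in>D. a \<in> mball x r" unfolding metric_closure_of by blast
    moreover have "1 / real (Suc n) > 0" by simp
    ultimately obtain a where a: "a \<in> D" "a \<in> mball x (1 / Suc n)" by blast
    have "mball a (1 / Suc n) \<subseteq> mball x r"
      using a(2) n by (intro mball_subset) (auto simp: commute)
    moreover have "x \<in> mball a (1 / Suc n)" using a(2) by (simp add: commute)
    moreover have "mball a (1 / Suc n) \<in> \<B>"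
      using a(1) unfolding \<B>_def by (intro image_eqI[of _ _ "(a, n)"]) auto
    ultimately show ?thesis using r(2) by blast
  qed
  moreover have "countable \<B>" using D(1) by (simp add: \<B>_def)
  moreover have "\<forall>V\<in>\<B>. openin mtopology V" by (auto simp: \<B>_def)
  ultimately show ?thesis unfolding second_countable_def X
    by (intro exI[of _ \<B>]) simp
qed

lemma polish_topology_closedin:
  assumes "polish_topology X" "closedin X C"
  shows "polish_topology (subtopology X C)"
  unfolding polish_topology_def
proof
  show "completely_metrizable_space (subtopology X C)"
    using assms by (simp add: polish_topology_def completely_metrizable_space_closedin)
  show "separable_space (subtopology X C)"
    by (intro second_countable_imp_separable_space second_countable_subtopology
        polish_second_countable assms(1))
qed

lemma polish_topology_prod:
  assumes "polish_topology X" "polish_topology Y"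
  shows "polish_topology (prod_topology X Y)"
proof -
  obtain C D where C: "countable C" "C \<subseteq> topspace X" "X closure_of C = topspace X"
    and D: "countable D" "D \<subseteq> topspace Y" "Y closure_of D = topspace Y"
    using assms by (auto simp: polish_topology_def separable_space_def)
  have "separable_space (prod_topology X Y)"
    unfolding separable_space_def
    by (rule exI[of _ "C \<times> D"]) (use C D in \<open>auto simp: closure_of_Times\<close>)
  then show ?thesis
    using assms by (auto simp: polish_topology_def completely_metrizable_space_prod_topology)
qed


section \<open>Meagre sets in products\<close>

lemma dense_openin_imp_nowhere_dense_Diff:
  assumes "openin X U" "X closure_of U = topspace X"
  shows "nowhere_dense_in X (topspace X - U)"
proof -
  have "closedin X (topspace X - U)" using assms(1) by (simp add: closedin_diff)
  then show ?thesis
    using assms(2) by (simp add: nowhere_dense_in_def closure_of_closedin interior_of_complement)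
qed

text \<open>For a nonempty basic open set \<open>V\<close>, the points \<open>x\<close> for which \<open>V\<close> misses the section of \<open>U\<close> at
  \<open>x\<close> form a closed set, nowhere dense because \<open>U\<close> meets every box with side \<open>V\<close>.\<close>

lemma meagre_in_nondense_sections:
  assumes Y: "second_countable Y"
    and U: "openin (prod_topology X Y) U"
    and dense: "prod_topology X Y closure_of U = topspace (prod_topology X Y)"
  shows "meagre_in X {x \<in> topspace X. Y closure_of {y. (x, y) \<in> U} \<noteq> topspace Y}"
proof -
  obtain \<B> where \<B>: "countable \<B>" "\<And>V. V \<in> \<B> \<Longrightarrow> openin Y V"
      "\<forall>W y. openin Y W \<and> y \<in> W \<longrightarrow> (\<exists>V\<in>\<B>. y \<in> V \<and> V \<subseteq> W)"
    using Y by (auto simp: second_countable_def)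
  define E where "E V = topspace X - fst ` (U \<inter> topspace X \<times> V)" for V
  have "nowhere_dense_in X (E V)" if V: "V \<in> \<B> - {{}}" for V
    unfolding E_def
  proof (rule dense_openin_imp_nowhere_dense_Diff)
    have "openin (prod_topology X Y) (U \<inter> topspace X \<times> V)"
      using U \<B>(2) V by (intro openin_Int) (auto simp: openin_prod_Times_iff)
    then show "openin X (fst ` (U \<inter> topspace X \<times> V))"
      by (rule open_map_fst[unfolded open_map_def, rule_format])
    show "X closure_of fst ` (U \<inter> topspace X \<times> V) = topspace X"
      unfolding dense_intersects_open
    proof (intro allI impI)
      fix W assume W: "openin X W \<and> W \<noteq> {}"
      then have "openin (prod_topology X Y) (W \<times> V)" "W \<times> V \<noteq> {}"
        using V \<B>(2) by (auto simp: openin_prod_Times_iff)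
      then have "U \<inter> W \<times> V \<noteq> {}" using dense unfolding dense_intersects_open by blast
      then obtain x y where "(x, y) \<in> U" "x \<in> W" "y \<in> V" by blast
      moreover have "x \<in> topspace X" using W openin_subset \<open>x \<in> W\<close> by blast
      ultimately have "x \<in> fst ` (U \<inter> topspace X \<times> V)"
        by (intro image_eqI[of _ _ "(x, y)"]) auto
      then show "fst ` (U \<inter> topspace X \<times> V) \<inter> W \<noteq> {}" using \<open>x \<in> W\<close> by blast
    qed
  qed
  then have "meagre_in X (\<Union>V\<in>\<B> - {{}}. E V)"
    by (intro meagre_in_UN nowhere_dense_imp_meagre_in) (use \<B>(1) in auto)
  then show ?thesis
  proof (rule meagre_in_subset, intro subsetI)
    fix x assume "x \<in> {x \<in> topspace X. Y closure_of {y. (x, y) \<in> U} \<noteq> topspace Y}"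
    then obtain W where x: "x \<in> topspace X"
      and W: "openin Y W" "W \<noteq> {}" "{y. (x, y) \<in> U} \<inter> W = {}"
      unfolding dense_intersects_open by blast
    then obtain y where "y \<in> W" by blast
    then obtain V where "V \<in> \<B> - {{}}" "V \<subseteq> W" using \<B>(3) W(1) by blast
    moreover from this have "x \<notin> fst ` (U \<inter> topspace X \<times> V)" using W(3) by auto
    ultimately show "x \<in> (\<Union>V\<in>\<B> - {{}}. E V)" using x unfolding E_def by blast
  qed
qed

lemma meagre_in_nonmeagre_sections:
  assumes Y: "second_countable Y" and A: "meagre_in (prod_topology X Y) A"
  shows "meagre_in X {x \<in> topspace X. \<not> meagre_in Y {y. (x, y) \<in> A}}"
proof -
  let ?P = "prod_topology X Y"
  obtain \<N> where \<N>: "countable \<N>" "\<forall>N\<in>\<N>. nowhere_dense_in ?P N" "A = \<Union>\<N>"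
    using A unfolding meagre_in_iff by blast
  define U where "U N = topspace ?P - ?P closure_of N" for N
  have "meagre_in X {x \<in> topspace X. Y closure_of {y. (x, y) \<in> U N} \<noteq> topspace Y}"
    if "N \<in> \<N>" for N
  proof (rule meagre_in_nondense_sections[OF Y])
    show "openin ?P (U N)" unfolding U_def by (intro openin_diff openin_topspace closedin_closure_of)
    show "?P closure_of U N = topspace ?P"
      using \<N>(2) that closure_of_subset_topspace[of ?P N]
      unfolding U_def nowhere_dense_in_def closure_of_complement by simp
  qed
  then have "meagre_in X (\<Union>N\<in>\<N>. {x \<in> topspace X. Y closure_of {y. (x, y) \<in> U N} \<noteq> topspace Y})"
    by (intro meagre_in_UN \<N>(1))
  moreover have "meagre_in Y {y. (x, y) \<in> A}"
    if dense: "\<And>N. N \<in> \<N> \<Longrightarrow> Y closure_of {y. (x, y) \<in> U N} = topspace Y" for x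
  proof -
    have "nowhere_dense_in Y {y. (x, y) \<in> N}" if N: "N \<in> \<N>" for N
    proof (rule nowhere_dense_in_subset[OF dense_openin_imp_nowhere_dense_Diff])
      have op: "openin ?P (U N)"
        unfolding U_def by (intro openin_diff openin_topspace closedin_closure_of)
      have "\<exists>V. openin Y V \<and> y \<in> V \<and> V \<subseteq> {y. (x, y) \<in> U N}" if y: "(x, y) \<in> U N" for y
      proof -
        obtain A V where "openin Y V" "x \<in> A" "y \<in> V" "A \<times> V \<subseteq> U N"
          using op[unfolded openin_prod_topology_alt, rule_format, OF y] by auto
        then show ?thesis by (intro exI[of _ V]) auto
      qed
      then show "openin Y {y. (x, y) \<in> U N}"
        by (subst openin_subopen) blast
      show "Y closure_of {y. (x, y) \<in> U N} = topspace Y" using N by (rule dense)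
      have "N \<subseteq> topspace ?P" using \<N>(2) N unfolding nowhere_dense_in_def by blast
      then show "{y. (x, y) \<in> N} \<subseteq> topspace Y - {y. (x, y) \<in> U N}"
        using closure_of_subset[of N ?P] unfolding U_def by auto
    qed
    then have "meagre_in Y (\<Union>N\<in>\<N>. {y. (x, y) \<in> N})"
      by (intro meagre_in_UN \<N>(1) nowhere_dense_imp_meagre_in)
    moreover have "{y. (x, y) \<in> A} = (\<Union>N\<in>\<N>. {y. (x, y) \<in> N})" using \<N>(3) by blast
    ultimately show ?thesis by simp
  qed
  then have "{x \<in> topspace X. \<not> meagre_in Y {y. (x, y) \<in> A}}
      \<subseteq> (\<Union>N\<in>\<N>. {x \<in> topspace X. Y closure_of {y. (x, y) \<in> U N} \<noteq> topspace Y})"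
    by blast
  ultimately show ?thesis by (rule meagre_in_subset)
qed

text \<open>The direction of the Kuratowski--Ulam theorem that passes from sections to the plane. If a set
  \<open>A\<close> with the Baire property is not meagre, it is almost all of a box; a generic vertical section
  of the box is then, up to a meagre set, a section of \<open>A\<close>.\<close>

lemma meagre_in_prod_of_sections:
  assumes X: "completely_metrizable_space X"
    and Y: "completely_metrizable_space Y" "second_countable Y"
    and A: "baire_property_in (prod_topology X Y) A"
    and sections: "\<And>x. x \<in> topspace X \<Longrightarrow> meagre_in Y {y. (x, y) \<in> A}"
  shows "meagre_in (prod_topology X Y) A"
proof -
  let ?P = "prod_topology X Y"
  obtain U where U: "openin ?P U" "meagre_in ?P (sym_diff A U)"
    using A unfolding baire_property_in_def by blast
  have "U = {}"
  proof (rule ccontr)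
    assume "U \<noteq> {}"
    then obtain a b where "(a, b) \<in> U" by auto
    then obtain V W where V: "openin X V" "V \<noteq> {}" and W: "openin Y W" "W \<noteq> {}"
      and VW: "V \<times> W \<subseteq> U"
      using U(1)[unfolded openin_prod_topology_alt, rule_format, of a b] by auto
    have "meagre_in X {x \<in> topspace X. \<not> meagre_in Y {y. (x, y) \<in> sym_diff A U}}"
      by (rule meagre_in_nonmeagre_sections[OF Y(2) U(2)])
    then have "\<not> V \<subseteq> {x \<in> topspace X. \<not> meagre_in Y {y. (x, y) \<in> sym_diff A U}}"
      using openin_meagre_in_empty[OF X V(1)] V(2) meagre_in_subset by blast
    then obtain x where x: "x \<in> V" "meagre_in Y {y. (x, y) \<in> sym_diff A U}"
      using openin_subset[OF V(1)] by blast
    have "meagre_in Y ({y. (x, y) \<in> A} \<union> {y. (x, y) \<in> sym_diff A U})"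
      using sections x openin_subset[OF V(1)] by (intro meagre_in_Un) auto
    moreover have "W \<subseteq> {y. (x, y) \<in> A} \<union> {y. (x, y) \<in> sym_diff A U}"
      using x(1) VW by blast
    ultimately show False
      using openin_meagre_in_empty[OF Y(1) W(1)] W(2) meagre_in_subset by blast
  qed
  then show ?thesis using U(2) by simp
qed


section \<open>Groups acting by homeomorphisms\<close>

text \<open>The maps of a \<open>group_action\<close> are extensional on the space acted on, so restricting the action
  to an invariant subset would require changing them. This locale asks for the action laws on the
  space only.\<close>

locale homeomorphism_action = group G for G (structure) +
  fixes Z :: "'x topology" and \<phi> :: "'a \<Rightarrow> 'x \<Rightarrow> 'x"
  assumes continuous: "g \<in> carrier G \<Longrightarrow> continuous_map Z Z (\<phi> g)"
    and act_one: "z \<in> topspace Z \<Longrightarrow> \<phi> \<one> z = z"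
    and act_mult: "g \<in> carrier G \<Longrightarrow> h \<in> carrier G \<Longrightarrow> z \<in> topspace Z \<Longrightarrow> \<phi> (g \<otimes> h) z = \<phi> g (\<phi> h z)"
begin

lemma act_closed: "g \<in> carrier G \<Longrightarrow> z \<in> topspace Z \<Longrightarrow> \<phi> g z \<in> topspace Z"
  using continuous by (auto simp: continuous_map_def Pi_iff)

lemma act_inv_act: "g \<in> carrier G \<Longrightarrow> z \<in> topspace Z \<Longrightarrow> \<phi> (inv g) (\<phi> g z) = z"
  using act_mult[of "inv g" g z] by (simp add: act_one)

lemma act_act_inv: "g \<in> carrier G \<Longrightarrow> z \<in> topspace Z \<Longrightarrow> \<phi> g (\<phi> (inv g) z) = z"
  using act_mult[of g "inv g" z] by (simp add: act_one)

lemma homeomorphic: "g \<in> carrier G \<Longrightarrow> homeomorphic_map Z Z (\<phi> g)"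
  unfolding homeomorphic_map_maps homeomorphic_maps_def
  by (intro exI[of _ "\<phi> (inv g)"]) (simp add: continuous act_inv_act act_act_inv)

lemma openin_image: "g \<in> carrier G \<Longrightarrow> openin Z U \<Longrightarrow> openin Z (\<phi> g ` U)"
  using homeomorphic_map_openness[OF homeomorphic] openin_subset by blast

lemma closedin_image: "g \<in> carrier G \<Longrightarrow> closedin Z C \<Longrightarrow> closedin Z (\<phi> g ` C)"
  using homeomorphic_map_closedness[OF homeomorphic] closedin_subset by blast

lemma image_mult:
  assumes "g \<in> carrier G" "h \<in> carrier G" "A \<subseteq> topspace Z"
  shows "\<phi> (g \<otimes> h) ` A = \<phi> g ` \<phi> h ` A"
  using assms by (force simp: act_mult image_image)

lemma orbit_closed: "z \<in> topspace Z \<Longrightarrow> orbit G \<phi> z \<subseteq> topspace Z"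
  by (auto simp: orbit_def act_closed)

lemma orbit_self: "z \<in> topspace Z \<Longrightarrow> z \<in> orbit G \<phi> z"
  unfolding orbit_def using act_one one_closed by force

lemma act_orbit: "z \<in> topspace Z \<Longrightarrow> g \<in> carrier G \<Longrightarrow> w \<in> orbit G \<phi> z \<Longrightarrow> \<phi> g w \<in> orbit G \<phi> z"
  by (auto simp: orbit_def act_mult[symmetric])

lemma restrict_to_invariant:
  assumes "C \<subseteq> topspace Z" "\<And>g z. g \<in> carrier G \<Longrightarrow> z \<in> C \<Longrightarrow> \<phi> g z \<in> C"
  shows "homeomorphism_action G (subtopology Z C) \<phi>"
proof
  show "continuous_map (subtopology Z C) (subtopology Z C) (\<phi> g)" if "g \<in> carrier G" for g
    unfolding continuous_map_in_subtopology
    using assms(2) that continuous by (auto intro: continuous_map_from_subtopology)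
qed (use assms(1) in \<open>auto simp: act_one act_mult\<close>)

lemma closure_of_orbit_invariant:
  assumes "z \<in> topspace Z" "g \<in> carrier G" "w \<in> Z closure_of orbit G \<phi> z"
  shows "\<phi> g w \<in> Z closure_of orbit G \<phi> z"
proof -
  have "\<phi> g ` orbit G \<phi> z \<subseteq> orbit G \<phi> z" using act_orbit assms by blast
  moreover have "\<phi> g ` (Z closure_of orbit G \<phi> z) = Z closure_of \<phi> g ` orbit G \<phi> z"
    using homeomorphic_map_closure_of[OF homeomorphic orbit_closed] assms by metis
  ultimately show ?thesis using assms(3) closure_of_mono by blast
qed

end

lemma continuous_action_imp_homeomorphism_action:
  assumes G: "topological_group G T" and act: "continuous_action G T X \<phi>"
  shows "homeomorphism_action G X \<phi>"
proof -
  interpret group G using G by (simp add: topological_group_def)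
  interpret group_action G "topspace X" \<phi> using act by (simp add: continuous_action_def)
  show ?thesis
  proof
    fix g assume g: "g \<in> carrier G"
    then have "continuous_map X (prod_topology T X) (\<lambda>x. (g, x))"
      using G by (auto simp: topological_group_def continuous_map_pairwise o_def)
    from continuous_map_compose[OF this, of X "\<lambda>(g, x). \<phi> g x"]
    show "continuous_map X X (\<phi> g)"
      using act by (simp add: continuous_action_def o_def)
  next
    show "\<phi> \<one>\<^bsub>G\<^esub> z = z" if "z \<in> topspace X" for z
      using that id_eq_one by (metis restrict_apply')
  qed (simp add: composition_rule)
qed


section \<open>Embedding \<open>E0\<close> when a meagre relation contains a dense orbit relation\<close>

context homeomorphism_action
begin

text \<open>The pairs whose images under two members of \<open>A\<close> lie in a member of \<open>\<K>\<close> form a closed set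
  without interior, so some box \<open>V \<times> W\<close> inside \<open>U \<times> U\<close> avoids them. As the orbit is dense, a group
  element \<open>g\<close> carries a point of \<open>V\<close> into \<open>W\<close>; shrinking \<open>V\<close> to the part that \<open>g\<close> maps into \<open>W\<close>
  turns the box into the pair of sets \<open>V\<close> and \<open>\<phi> g ` V\<close>.\<close>

lemma avoid_closed_nowhere_dense:
  assumes Z: "completely_metrizable_space Z"
    and x: "x \<in> topspace Z" "Z closure_of orbit G \<phi> x = topspace Z"
    and A: "finite A" "A \<subseteq> carrier G"
    and \<K>: "finite \<K>" "\<And>K. K \<in> \<K> \<Longrightarrow> closedin (prod_topology Z Z) K"
      "\<And>K. K \<in> \<K> \<Longrightarrow> prod_topology Z Z interior_of K = {}"
    and U: "openin Z U" "U \<noteq> {}"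
  obtains g V where "g \<in> carrier G" "openin Z V" "V \<noteq> {}" "V \<subseteq> U" "\<phi> g ` V \<subseteq> U"
    "\<And>a b K u v. a \<in> A \<Longrightarrow> b \<in> A \<Longrightarrow> K \<in> \<K> \<Longrightarrow> u \<in> V \<Longrightarrow> v \<in> V \<Longrightarrow> (\<phi> a u, \<phi> b (\<phi> g v)) \<notin> K"
proof -
  let ?P = "prod_topology Z Z"
  define f where "f = (\<lambda>(a, b) (u, v). (\<phi> a u, \<phi> b v))"
  define bad where "bad = (\<Union>p\<in>A \<times> A. (\<lambda>K. {w \<in> topspace ?P. f p w \<in> K}) ` \<K>)"
  have f: "homeomorphic_map ?P ?P (f p)" if p: "p \<in> A \<times> A" for p
  proof -
    obtain a b where ab: "p = (a, b)" "a \<in> carrier G" "b \<in> carrier G"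
      using p A(2) by blast
    then obtain f1 f2 where "homeomorphic_maps Z Z (\<phi> a) f1" "homeomorphic_maps Z Z (\<phi> b) f2"
      using homeomorphic unfolding homeomorphic_map_maps by blast
    then have "homeomorphic_maps ?P ?P (\<lambda>(u, v). (\<phi> a u, \<phi> b v)) (\<lambda>(u, v). (f1 u, f2 v))"
      by (simp add: homeomorphic_maps_prod)
    then show ?thesis unfolding ab f_def prod.case homeomorphic_map_maps by blast
  qed
  have bad: "closedin ?P B \<and> ?P interior_of B = {}" if Bbad: "B \<in> bad" for B
  proof
    obtain p K where p: "p \<in> A \<times> A" and K: "K \<in> \<K>" and B: "B = {w \<in> topspace ?P. f p w \<in> K}"
      using Bbad unfolding bad_def by blast
    show "closedin ?P B"
      unfolding B using homeomorphic_imp_continuous_map[OF f[OF p]] \<K>(2)[OF K]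
      by (rule closedin_continuous_map_preimage)
    have "W = {}" if W: "openin ?P W" "W \<subseteq> B" for W
    proof -
      have "openin ?P (f p ` W)"
        using homeomorphic_map_openness[OF f[OF p] openin_subset[OF W(1)]] W(1) by simp
      moreover have "f p ` W \<subseteq> K" using W(2) B by blast
      ultimately show ?thesis using \<K>(3)[OF K] unfolding interior_of_eq_empty by blast
    qed
    then show "?P interior_of B = {}" unfolding interior_of_eq_empty by blast
  qed
  have "finite bad" using A \<K>(1) by (simp add: bad_def)
  moreover have "completely_metrizable_space ?P"
    using Z by (simp add: completely_metrizable_space_prod_topology)
  ultimately have "?P interior_of \<Union>bad = {}"
    using bad by (intro Baire_category_alt) (auto intro: countable_finite)
  moreover have "openin ?P (U \<times> U)" "U \<times> U \<noteq> {}" using U by (auto simp: openin_prod_Times_iff)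
  ultimately obtain w where w: "w \<in> U \<times> U - \<Union>bad"
    unfolding interior_of_eq_empty by blast
  have "closedin ?P (\<Union>bad)"
    using bad \<open>finite bad\<close> by (intro closedin_Union) auto
  then have op: "openin ?P (U \<times> U - \<Union>bad)"
    using \<open>openin ?P (U \<times> U)\<close> by (intro openin_diff)
  obtain w1 w2 where w12: "w = (w1, w2)" by (cases w)
  obtain V W where V: "openin Z V" "w1 \<in> V" and W: "openin Z W" "w2 \<in> W"
    and VW: "V \<times> W \<subseteq> U \<times> U - \<Union>bad"
    using op[unfolded openin_prod_topology_alt, rule_format, of w1 w2] w w12 by auto
  have VU: "V \<subseteq> U" and WU: "W \<subseteq> U" using VW V W by auto
  have "orbit G \<phi> x \<inter> V \<noteq> {}" "orbit G \<phi> x \<inter> W \<noteq> {}"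
    using x(2) V W unfolding dense_intersects_open by blast+
  then obtain h k where h: "h \<in> carrier G" "\<phi> h x \<in> V" and k: "k \<in> carrier G" "\<phi> k x \<in> W"
    unfolding orbit_def by blast
  define g where "g = k \<otimes> inv h"
  have g: "g \<in> carrier G" using h k by (simp add: g_def)
  have ghx: "\<phi> g (\<phi> h x) = \<phi> k x"
    unfolding g_def using h k x(1) by (simp add: act_mult act_closed act_inv_act)
  define V' where "V' = V \<inter> {z \<in> topspace Z. \<phi> g z \<in> W}"
  show ?thesis
  proof (rule that[of g V'])
    show "g \<in> carrier G" by (rule g)
    show "openin Z V'"
      unfolding V'_def using V(1) openin_continuous_map_preimage[OF continuous[OF g] W(1)]
      by (rule openin_Int)
    have "\<phi> h x \<in> V'"
      using h k x(1) ghx by (simp add: V'_def act_closed)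
    then show "V' \<noteq> {}" by blast
    show "V' \<subseteq> U" using VU unfolding V'_def by blast
    show "\<phi> g ` V' \<subseteq> U" using WU unfolding V'_def by blast
    fix a b K u v assume *: "a \<in> A" "b \<in> A" "K \<in> \<K>" "u \<in> V'" "v \<in> V'"
    then have uv: "u \<in> V" "\<phi> g v \<in> W" by (auto simp: V'_def)
    then have "(u, \<phi> g v) \<in> topspace ?P"
      using V W openin_subset by fastforce
    moreover have "(u, \<phi> g v) \<notin> \<Union>bad" using VW uv by blast
    moreover have "{w \<in> topspace ?P. f (a, b) w \<in> K} \<in> bad"
      using * unfolding bad_def by blast
    ultimately have "f (a, b) (u, \<phi> g v) \<notin> K" by blast
    then show "(\<phi> a u, \<phi> b (\<phi> g v)) \<notin> K" by (simp add: f_def)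
  qed
qed

text \<open>Continuity of finitely many maps at one point of \<open>V\<close> makes all their images of a small ball small.\<close>

lemma shrink_images:
  assumes M: "Metric_space M d" "Z = Metric_space.mtopology M d"
    and B: "finite B" "B \<subseteq> carrier G" and V: "openin Z V" "V \<noteq> {}" and "\<epsilon> > 0"
  obtains U where "openin Z U" "U \<noteq> {}" "Z closure_of U \<subseteq> V"
    "\<And>b. b \<in> B \<Longrightarrow> \<exists>p. \<phi> b ` (Z closure_of U) \<subseteq> Metric_space.mball M d p \<epsilon>"
proof -
  interpret Metric_space M d by (rule M)
  obtain v where v: "v \<in> V" using V(2) by blast
  then have vM: "v \<in> M" using V(1) openin_subset M(2) by fastforce
  define Q where "Q b = {z \<in> topspace Z. \<phi> b z \<in> mball (\<phi> b v) \<epsilon>}" for b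
  define W where "W = V \<inter> \<Inter>(Q ` B)"
  have "openin Z (Q b)" if "b \<in> B" for b
    unfolding Q_def by (rule openin_continuous_map_preimage[OF continuous])
      (use that B(2) M(2) in auto)
  then have "openin Z W"
    unfolding W_def using V(1) B(1) by (cases "B = {}") (auto intro!: openin_Int openin_INT2)
  moreover have "v \<in> W"
    using v vM B(2) M(2) act_closed \<open>\<epsilon> > 0\<close> by (auto simp: W_def Q_def subset_iff)
  ultimately obtain r where r: "r > 0" "mcball v r \<subseteq> W"
    unfolding M(2) openin_mtopology_mcball by auto
  have cl: "Z closure_of mball v r \<subseteq> W"
    using r(2) closure_of_minimal[OF mball_subset_mcball closedin_mcball, of v r] unfolding M(2) by blast
  show ?thesis
  proof (rule that[of "mball v r"])
    show "openin Z (mball v r)" by (simp add: M(2))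
    show "mball v r \<noteq> {}" using vM r(1) centre_in_mball_iff by blast
    show "Z closure_of mball v r \<subseteq> V" using cl unfolding W_def by blast
    show "\<exists>p. \<phi> b ` (Z closure_of mball v r) \<subseteq> mball p \<epsilon>" if "b \<in> B" for b
      using cl that unfolding W_def Q_def by (intro exI[of _ "\<phi> b v"]) blast
  qed
qed

text \<open>New generators are multiplied on the right, so two words with the same tail differ by a left
  factor, and acting by that factor carries the points coded by one word to those coded by the
  other.\<close>

primrec word :: "(nat \<Rightarrow> 'a) \<Rightarrow> (nat \<Rightarrow> bool) \<Rightarrow> nat \<Rightarrow> 'a" where
  "word g c 0 = \<one>"
| "word g c (Suc n) = word g c n \<otimes> (if c n then g n else \<one>)"

lemma word_closed: "(\<And>i. g i \<in> carrier G) \<Longrightarrow> word g c n \<in> carrier G"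
  by (induction n) auto

lemma word_cong: "(\<And>i. i < n \<Longrightarrow> c i = d i) \<Longrightarrow> word g c n = word g d n"
  by (induction n) auto

lemma word_eventually_left_translate:
  assumes g: "\<And>i. g i \<in> carrier G" and cd: "\<And>i. i \<ge> m \<Longrightarrow> c i = d i"
  obtains k where "k \<in> carrier G" "\<And>n. n \<ge> m \<Longrightarrow> word g c n = k \<otimes> word g d n"
proof
  let ?k = "word g c m \<otimes> inv word g d m"
  show "?k \<in> carrier G" using g by (simp add: word_closed)
  show "word g c n = ?k \<otimes> word g d n" if "n \<ge> m" for n
    using that
  proof (induction n rule: dec_induct)
    case base
    show ?case using g by (simp add: word_closed m_assoc)
  next
    case (step n)
    then show ?case using g cd[of n] by (simp add: word_closed m_assoc)
  qed
qed

text \<open>The inductive construction behind the embedding. The set \<open>\<phi> (word g c n) ` U n\<close> is the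
  piece of the \<open>n\<close>-th approximation that is assigned to the first \<open>n\<close> entries of \<open>c\<close>. The pieces
  shrink to points, and two pieces for sequences that differ at \<open>n\<close> form
  a pair avoiding \<open>K 0, \<dots>, K n\<close>. Everything is required of closures, because the
  limit points only lie in the closed pieces.\<close>

lemma E0_scheme:
  assumes M: "Metric_space M d" "Z = Metric_space.mtopology M d" "Metric_space.mcomplete M d"
    and x: "x \<in> topspace Z" "Z closure_of orbit G \<phi> x = topspace Z"
    and K: "\<And>n::nat. closedin (prod_topology Z Z) (K n)"
      "\<And>n. prod_topology Z Z interior_of (K n) = {}"
  obtains g U where "\<And>n. g n \<in> carrier G" "\<And>n. openin Z (U n)" "\<And>n. U n \<noteq> {}"
    "\<And>n. Z closure_of U (Suc n) \<subseteq> U n" "\<And>n. \<phi> (g n) ` (Z closure_of U (Suc n)) \<subseteq> U n"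
    "\<And>c n. \<exists>p. \<phi> (word g c (Suc n)) ` (Z closure_of U (Suc n))
        \<subseteq> Metric_space.mball M d p (1 / Suc n)"
    "\<And>b c n k u v. k \<le> n \<Longrightarrow> u \<in> Z closure_of U (Suc n) \<Longrightarrow> v \<in> Z closure_of U (Suc n) \<Longrightarrow>
        (\<phi> (word g b n) u, \<phi> (word g c n \<otimes> g n) v) \<notin> K k"
proof -
  interpret Metric_space M d by (rule M)
  have Z: "completely_metrizable_space Z"
    using M completely_metrizable_space_def by blast
  \<comment> \<open>The state is the finite set \<open>A\<close> of all words of the current length and the current open set.\<close>
  define good where "good n A U A' U' g \<longleftrightarrow> g \<in> carrier G \<and> A' = A \<union> (\<lambda>a. a \<otimes> g) ` A \<and>
      Z closure_of U' \<subseteq> U \<and> \<phi> g ` (Z closure_of U') \<subseteq> U \<and>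
      (\<forall>a\<in>A'. \<exists>p. \<phi> a ` (Z closure_of U') \<subseteq> mball p (1 / Suc n)) \<and>
      (\<forall>a\<in>A. \<forall>b\<in>A. \<forall>k\<le>n. \<forall>u\<in>Z closure_of U'. \<forall>v\<in>Z closure_of U'.
         (\<phi> a u, \<phi> (b \<otimes> g) v) \<notin> K k)" for n A U A' U' g
  define ok where "ok = (\<lambda>(A, U). finite A \<and> A \<subseteq> carrier G \<and> \<one> \<in> A \<and> openin Z U \<and> U \<noteq> {})"
  have step: "\<exists>s'. ok s' \<and> (\<exists>g. good n (fst s) (snd s) (fst s') (snd s') g)" if s: "ok s" for s n
  proof -
    obtain A U where [simp]: "s = (A, U)" by (cases s)
    have A: "finite A" "A \<subseteq> carrier G" "\<one> \<in> A" and U: "openin Z U" "U \<noteq> {}"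
      using s by (auto simp: ok_def)
    have "finite (K ` {..n})" by simp
    then obtain g V where g: "g \<in> carrier G" and V: "openin Z V" "V \<noteq> {}" "V \<subseteq> U" "\<phi> g ` V \<subseteq> U"
      and avoid: "\<And>a b L u v. a \<in> A \<Longrightarrow> b \<in> A \<Longrightarrow> L \<in> K ` {..n} \<Longrightarrow> u \<in> V \<Longrightarrow> v \<in> V \<Longrightarrow>
          (\<phi> a u, \<phi> b (\<phi> g v)) \<notin> L"
      using K by (elim avoid_closed_nowhere_dense[OF Z x A(1,2) _ _ _ U]) auto
    define A' where "A' = A \<union> (\<lambda>a. a \<otimes> g) ` A"
    have A': "finite A'" "A' \<subseteq> carrier G" "\<one> \<in> A'" using A g by (auto simp: A'_def)
    obtain U' where U': "openin Z U'" "U' \<noteq> {}" "Z closure_of U' \<subseteq> V"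
      and small: "\<And>a. a \<in> A' \<Longrightarrow> \<exists>p. \<phi> a ` (Z closure_of U') \<subseteq> mball p (1 / Suc n)"
      by (rule shrink_images[OF M(1,2) A'(1,2) V(1,2), of "1 / Suc n"]) auto
    have "(\<phi> a u, \<phi> (b \<otimes> g) v) \<notin> K k"
      if "a \<in> A" "b \<in> A" "k \<le> n" "u \<in> Z closure_of U'" "v \<in> Z closure_of U'" for a b k u v
    proof -
      have "v \<in> topspace Z" using that(5) in_closure_of by metis
      then have "\<phi> (b \<otimes> g) v = \<phi> b (\<phi> g v)" using A(2) that(2) g by (intro act_mult) auto
      then show ?thesis using avoid[of a b "K k" u v] that U'(3) by auto
    qed
    moreover have "Z closure_of U' \<subseteq> U" "\<phi> g ` (Z closure_of U') \<subseteq> U"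
      using U'(3) V(3,4) by blast+
    ultimately have "good n A U A' U' g"
      unfolding good_def by (intro conjI ballI allI impI g A'_def small)
    moreover have "ok (A', U')" using A' U' by (simp add: ok_def)
    ultimately show ?thesis by (intro exI[of _ "(A', U')"]) auto
  qed
  have "ok ({\<one>}, topspace Z)" using x(1) by (auto simp: ok_def)
  then obtain s where s: "\<And>n::nat. ok (s n)"
      "\<And>n. \<exists>g. good n (fst (s n)) (snd (s n)) (fst (s (Suc n))) (snd (s (Suc n))) g"
      and s0: "s 0 = ({\<one>}, topspace Z)"
    using dependent_nat_choice[of "\<lambda>n s. ok s \<and> (n = 0 \<longrightarrow> s = ({\<one>}, topspace Z))"
        "\<lambda>n s s'. \<exists>g. good n (fst s) (snd s) (fst s') (snd s') g"] step by (metis nat.distinct(1))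
  define A U where "A n = fst (s n)" and "U n = snd (s n)" for n
  obtain g where g: "\<And>n. good n (A n) (U n) (A (Suc n)) (U (Suc n)) (g n)"
    using s(2) unfolding A_def U_def by metis
  have word: "word g c n \<in> A n" for c n
  proof (induction n)
    case 0
    show ?case using s(1)[of 0] by (auto simp: ok_def A_def)
  next
    case (Suc n)
    moreover have "A n \<subseteq> carrier G" using s(1)[of n] by (auto simp: ok_def A_def)
    moreover have "A (Suc n) = A n \<union> (\<lambda>a. a \<otimes> g n) ` A n" using g[of n] by (simp add: good_def)
    ultimately show ?case by auto
  qed
  show ?thesis
  proof (rule that[of g U])
    fix n
    show "g n \<in> carrier G" "Z closure_of U (Suc n) \<subseteq> U n"
      "\<phi> (g n) ` (Z closure_of U (Suc n)) \<subseteq> U n"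
      using g[of n] by (auto simp: good_def)
    show "openin Z (U n)" "U n \<noteq> {}" using s(1)[of n] by (auto simp: ok_def U_def)
    show "\<exists>p. \<phi> (word g c (Suc n)) ` (Z closure_of U (Suc n)) \<subseteq> mball p (1 / Suc n)" for c
      using g[of n] word[of c "Suc n"] unfolding good_def by blast
    show "(\<phi> (word g b n) u, \<phi> (word g c n \<otimes> g n) v) \<notin> K k"
      if "k \<le> n" "u \<in> Z closure_of U (Suc n)" "v \<in> Z closure_of U (Suc n)" for b c k u v
      using g[of n] word[of b n] word[of c n] that unfolding good_def by blast
  qed
qed

text \<open>Sequences with the same tail are sent to the same orbit, because their words differ by a left
  factor. Sequences that differ infinitely often are sent to a pair outside \<open>F\<close>, because that pair, in
  one of the two orders, avoids every member of a cover of \<open>F\<close> by nowhere dense sets; symmetry makes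
  the order irrelevant.\<close>

theorem E0_embeds_in_meagre:
  assumes Z: "completely_metrizable_space Z"
    and x: "x \<in> topspace Z" "Z closure_of orbit G \<phi> x = topspace Z"
    and F: "meagre_in (prod_topology Z Z) F" "sym F"
      "\<And>g z. g \<in> carrier G \<Longrightarrow> z \<in> topspace Z \<Longrightarrow> (z, \<phi> g z) \<in> F"
  obtains \<pi> where "continuous_map cantor_space Z \<pi>" "\<And>c d. (c, d) \<in> E0 \<longleftrightarrow> (\<pi> c, \<pi> d) \<in> F"
proof -
  obtain M d where M: "Metric_space M d" "Metric_space.mcomplete M d" "Z = Metric_space.mtopology M d"
    using Z by (auto simp: completely_metrizable_space_def)
  interpret Metric_space M d by (rule M)
  let ?P = "prod_topology Z Z"
  obtain \<N> where \<N>: "countable \<N>" "\<forall>N\<in>\<N>. nowhere_dense_in ?P N" "F = \<Union>\<N>"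
    using F(1) unfolding meagre_in_iff by blast
  have "F \<noteq> {}" using F(3)[OF one_closed x(1)] by blast
  then have "\<N> \<noteq> {}" using \<N>(3) by blast
  define K where "K n = ?P closure_of from_nat_into \<N> n" for n
  have nd: "nowhere_dense_in ?P (from_nat_into \<N> n)" for n
    using \<N>(2) from_nat_into[OF \<open>\<N> \<noteq> {}\<close>] by blast
  have K: "closedin ?P (K n)" "?P interior_of (K n) = {}" for n
    using nd[of n] by (auto simp: K_def nowhere_dense_in_def)
  have FK: "\<exists>n. p \<in> K n" if pF: "p \<in> F" for p
  proof -
    obtain N where "p \<in> N" "N \<in> \<N>" using pF \<N>(3) by blast
    then obtain n where "p \<in> from_nat_into \<N> n" using from_nat_into_surj[OF \<N>(1)] by metis
    then show ?thesis
      using closure_of_subset[of "from_nat_into \<N> n" ?P] nd[of n]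
      unfolding K_def nowhere_dense_in_def by blast
  qed
  obtain g U where g: "\<And>n. g n \<in> carrier G" and U: "\<And>n. openin Z (U n)" "\<And>n. U n \<noteq> {}"
    and nest: "\<And>n. Z closure_of U (Suc n) \<subseteq> U n" "\<And>n. \<phi> (g n) ` (Z closure_of U (Suc n)) \<subseteq> U n"
    and small: "\<And>c n. \<exists>p. \<phi> (word g c (Suc n)) ` (Z closure_of U (Suc n)) \<subseteq> mball p (1 / Suc n)"
    and avoid: "\<And>b c n k u v. k \<le> n \<Longrightarrow> u \<in> Z closure_of U (Suc n) \<Longrightarrow> v \<in> Z closure_of U (Suc n) \<Longrightarrow>
        (\<phi> (word g b n) u, \<phi> (word g c n \<otimes> g n) v) \<notin> K k"
    by (fact E0_scheme[where K = K, OF M(1,3,2) x K])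
  have w: "word g c n \<in> carrier G" for c n using g by (rule word_closed)
  have clU: "U n \<subseteq> Z closure_of U n" "Z closure_of U n \<subseteq> topspace Z" for n
    using closure_of_subset openin_subset[OF U(1)] closure_of_subset_topspace by metis+
  define C where "C c n = \<phi> (word g c n) ` (Z closure_of U n)" for c n
  have C_Suc: "C c (Suc n) \<subseteq> C c n" for c n
  proof -
    let ?h = "if c n then g n else \<one>"
    have "\<phi> ?h ` (Z closure_of U (Suc n)) \<subseteq> U n"
      using nest[of n] clU(2)[of "Suc n"] by (auto simp: act_one subset_iff)
    moreover have "C c (Suc n) = \<phi> (word g c n) ` \<phi> ?h ` (Z closure_of U (Suc n))"
      unfolding C_def word.simps using w g clU by (intro image_mult) auto
    ultimately show ?thesis using clU(1)[of n] unfolding C_def by blast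
  qed
  then have C_dec: "decseq (C c)" for c by (simp add: decseq_Suc_iff)
  have C_closed: "closedin Z (C c n)" for c n
    unfolding C_def by (intro closedin_image w closedin_closure_of)
  have "\<exists>l. l \<in> M \<and> \<Inter> (range (C c)) = {l}" for c
  proof -
    have "C c n \<noteq> {}" for n using U(2)[of n] clU(1)[of n] unfolding C_def by blast
    moreover have "\<exists>n a. C c n \<subseteq> mcball a e" if "e > 0" for e
    proof -
      obtain n where "1 / real (Suc n) < e" using nat_approx_posE[OF \<open>e > 0\<close>] by blast
      moreover obtain p where "C c (Suc n) \<subseteq> mball p (1 / Suc n)" using small unfolding C_def by blast
      ultimately show ?thesis
        using mball_subset_mcball[of p "1 / Suc n"] mcball_subset_concentric[of "1 / Suc n" e p] by force
    qed
    ultimately show ?thesis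
      using M(2)[unfolded mcomplete_nest_sing, rule_format, of "C c"] C_closed C_dec M(3) by blast
  qed
  then obtain \<pi> where \<pi>: "\<And>c. \<Inter> (range (C c)) = {\<pi> c}" by metis
  have \<pi>C: "\<pi> c \<in> C c n" for c n using \<pi>[of c] by blast
  have C_top: "C c n \<subseteq> topspace Z" for c n using closedin_subset[OF C_closed] .
  have \<pi>Z: "\<pi> c \<in> topspace Z" for c using \<pi>C C_top by blast
  have "continuous_map cantor_space Z \<pi>"
    unfolding continuous_map_def
  proof (intro conjI allI impI)
    show "\<pi> \<in> topspace cantor_space \<rightarrow> topspace Z" using \<pi>Z by blast
    fix W assume W: "openin Z W"
    show "openin cantor_space {c \<in> topspace cantor_space. \<pi> c \<in> W}"
    proof (subst openin_subopen, intro ballI)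
      fix c assume "c \<in> {c \<in> topspace cantor_space. \<pi> c \<in> W}"
      then obtain e where e: "e > 0" "mball (\<pi> c) e \<subseteq> W"
        using W unfolding M(3) openin_mtopology by blast
      obtain n where n: "1 / real (Suc n) < e / 2" using nat_approx_posE[of "e / 2"] e(1) by auto
      obtain p where p: "C c (Suc n) \<subseteq> mball p (1 / Suc n)" using small unfolding C_def by blast
      have p': "\<pi> c \<in> mball p (1 / Suc n)" using p \<pi>C by blast
      have "mball p (1 / Suc n) \<subseteq> mball (\<pi> c) e"
        using p' n by (intro mball_subset) (auto simp: commute)
      then have CW: "C c (Suc n) \<subseteq> W" using p e(2) by blast
      define B where "B = (\<Pi>\<^sub>E i\<in>UNIV. if i < Suc n then {c i} else UNIV)"
      have "finite {i. (if i < Suc n then {c i} else UNIV) \<noteq> (UNIV :: bool set)}"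
        by (rule finite_subset[of _ "{..<Suc n}"]) auto
      then have "openin cantor_space B"
        unfolding cantor_space_def B_def by (intro product_topology_basis) auto
      moreover have "c \<in> B" by (auto simp: B_def)
      moreover have "\<pi> b \<in> W" if "b \<in> B" for b
      proof -
        have "b i = c i" if "i < Suc n" for i
          using \<open>b \<in> B\<close> that unfolding B_def by (auto dest!: PiE_mem[of _ _ _ i])
        then have "C b (Suc n) = C c (Suc n)"
          unfolding C_def using word_cong[of "Suc n" b c g] by simp
        then show ?thesis using \<pi>C[of b "Suc n"] CW by blast
      qed
      ultimately show "\<exists>V. openin cantor_space V \<and> c \<in> V \<and> V \<subseteq> {c \<in> topspace cantor_space. \<pi> c \<in> W}"
        using openin_subset[of cantor_space B] by (intro exI[of _ B]) auto
    qed
  qed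
  moreover have "(\<pi> c, \<pi> d) \<in> F" if cd: "(c, d) \<in> E0" for c d
  proof -
    obtain m where "\<forall>i\<ge>m. c i = d i" using cd by (auto simp: E0_def)
    then obtain k where k: "k \<in> carrier G" "\<And>n. n \<ge> m \<Longrightarrow> word g d n = k \<otimes> word g c n"
      using word_eventually_left_translate[of g m d c] g by metis
    have "\<phi> k (\<pi> c) \<in> C d n" if "n \<ge> m" for n
    proof -
      have "C d n = \<phi> k ` C c n"
        unfolding C_def k(2)[OF that] using k(1) w clU by (intro image_mult)
      then show ?thesis using \<pi>C by blast
    qed
    then have "\<phi> k (\<pi> c) \<in> C d n" for n
      using decseqD[OF C_dec, of n "max m n"] by (meson max.cobounded1 max.cobounded2 subsetD)
    then have "\<phi> k (\<pi> c) = \<pi> d" using \<pi>[of d] by blast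
    then show ?thesis using F(3)[OF k(1) \<pi>Z[of c]] by simp
  qed
  moreover have "(c, d) \<in> E0" if cd: "(\<pi> c, \<pi> d) \<in> F" for c d
  proof -
    \<comment> \<open>Once \<open>(\<pi> c, \<pi> d)\<close> lies in \<open>K k\<close>, no index from \<open>k\<close> on has \<open>c\<close> false and \<open>d\<close> true.\<close>
    have agree: "\<exists>m. \<forall>n\<ge>m. \<not> (\<not> c n \<and> d n)" if cd: "(\<pi> c, \<pi> d) \<in> F" for c d
    proof -
      obtain k where k: "(\<pi> c, \<pi> d) \<in> K k" using FK[OF cd] by blast
      have False if n: "n \<ge> k" "\<not> c n" "d n" for n
      proof -
        obtain u where u: "u \<in> Z closure_of U (Suc n)" "\<pi> c = \<phi> (word g c n) u"
          using \<pi>C[of c "Suc n"] n w[of c n] unfolding C_def by (auto simp: image_iff)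
        obtain v where v: "v \<in> Z closure_of U (Suc n)" "\<pi> d = \<phi> (word g d n \<otimes> g n) v"
          using \<pi>C[of d "Suc n"] n unfolding C_def by (auto simp: image_iff)
        show False using avoid[OF n(1) u(1) v(1), of c d] k u(2) v(2) by simp
      qed
      then show ?thesis by blast
    qed
    obtain m1 where m1: "\<forall>n\<ge>m1. \<not> (\<not> c n \<and> d n)" using agree[OF cd] by blast
    have "(\<pi> d, \<pi> c) \<in> F" using F(2) cd by (rule symD)
    then obtain m2 where m2: "\<forall>n\<ge>m2. \<not> (\<not> d n \<and> c n)" using agree by blast
    have "\<forall>n\<ge>max m1 m2. c n = d n" using m1 m2 by auto
    then show ?thesis unfolding E0_def by blast
  qed
  ultimately show ?thesis using that by blast
qed

end


section \<open>From generic points to open sets\<close>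

text \<open>The set \<open>C\<close> contains a Borel set \<open>D\<close> that is almost all of \<open>C\<close>. A Borel map that fixes \<open>D\<close> and
  sends everything else to one point of \<open>D\<close> pulls \<open>B\<close> back to a set with the Baire property that
  agrees with \<open>B\<close> on \<open>D\<close>.\<close>

lemma nonmeagre_universally_baire_in_subspace:
  assumes Z: "polish_topology Z"
    and sub: "subtopology X (topspace Z) = Z"
    and C: "C \<subseteq> topspace X" "baire_property_in Z (C \<inter> topspace Z)"
    and B: "universally_baire_in (subtopology X C) B" "\<not> meagre_in Z (B \<inter> topspace Z)"
  obtains W where "openin Z W" "W \<noteq> {}" "meagre_in Z (W - B)"
proof -
  obtain U where U: "openin Z U" "meagre_in Z (sym_diff (C \<inter> topspace Z) U)"
    using C(2) unfolding baire_property_in_def by blast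
  obtain \<N> where \<N>: "countable \<N>" "\<forall>N\<in>\<N>. nowhere_dense_in Z N"
      "sym_diff (C \<inter> topspace Z) U = \<Union>\<N>"
    using U(2)[unfolded meagre_in_iff] by (elim exE conjE) (rule that)
  \<comment> \<open>Removing closures of the exceptional nowhere dense sets leaves a Borel part of \<open>U\<close>.\<close>
  define L where "L = (\<Union>N\<in>\<N>. Z closure_of N)"
  define D where "D = U - L"
  have cl: "N \<subseteq> Z closure_of N" "nowhere_dense_in Z (Z closure_of N)" if "N \<in> \<N>" for N
  proof -
    have "nowhere_dense_in Z N" using \<N>(2) that by blast
    then show "N \<subseteq> Z closure_of N" "nowhere_dense_in Z (Z closure_of N)"
      by (simp_all add: nowhere_dense_in_def closure_of_subset closure_of_subset_topspace)
  qed
  have L: "meagre_in Z L"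
    unfolding L_def by (intro meagre_in_UN \<N>(1) nowhere_dense_imp_meagre_in cl(2))
  have NL: "sym_diff (C \<inter> topspace Z) U \<subseteq> L" unfolding \<N>(3) L_def using cl(1) by blast
  have U_top: "U \<subseteq> topspace Z" by (rule openin_subset[OF U(1)])
  have DC: "D \<subseteq> C" and DZ: "D \<subseteq> topspace Z" and CD: "C \<inter> topspace Z - D \<subseteq> L"
    using NL U_top unfolding D_def by blast+
  have BC: "B \<subseteq> C" using B(1) by (auto simp: universally_baire_in_def)
  have BD: "\<not> meagre_in Z (B \<inter> D)"
  proof
    assume "meagre_in Z (B \<inter> D)"
    then have "meagre_in Z (B \<inter> D \<union> L)" using L by (rule meagre_in_Un)
    moreover have "B \<inter> topspace Z \<subseteq> B \<inter> D \<union> L" using BC CD by blast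
    ultimately show False using B(2) meagre_in_subset by blast
  qed
  then obtain p where p: "p \<in> D" using meagre_in_UN[of "{}" Z] by fastforce
  have "L \<in> sets (borel_of Z)"
    unfolding L_def
  proof (rule sets.countable_UN''[OF \<N>(1)])
    show "Z closure_of N \<in> sets (borel_of Z)" for N by (intro closedin_borel_of) simp
  qed
  then have D_borel: "D \<in> sets (borel_of Z)"
    using openin_borel_of[OF U(1)] unfolding D_def by (rule sets.Diff[rotated])
  \<comment> \<open>The Baire property of \<open>B\<close> can be tested only along maps with values in \<open>C\<close>.\<close>
  define f where "f z = (if z \<in> D then z else p)" for z
  have f: "f \<in> measurable (borel_of Z) (borel_of (subtopology X C))"
    unfolding borel_of_def[of "subtopology X C"]
  proof (rule measurable_measure_of)
    show "{U. openin (subtopology X C) U} \<subseteq> Pow (topspace (subtopology X C))"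
      using openin_subset by blast
    show "f \<in> space (borel_of Z) \<rightarrow> topspace (subtopology X C)"
      using subsetD[OF subset_trans[OF DC C(1)]] subsetD[OF DC] p by (auto simp: f_def)
    fix V assume "V \<in> {U. openin (subtopology X C) U}"
    then obtain V' where V': "openin X V'" "V = V' \<inter> C" by (auto simp: openin_subtopology)
    have "openin Z (V' \<inter> topspace Z)" using V'(1) sub openin_subtopology by metis
    then have "(V' \<inter> topspace Z) \<inter> D \<in> sets (borel_of Z)"
      using D_borel openin_borel_of by blast
    moreover have "space (borel_of Z) - D \<in> sets (borel_of Z)"
      using D_borel by (rule sets.compl_sets)
    moreover have "f -` V \<inter> space (borel_of Z) =
        (V' \<inter> topspace Z) \<inter> D \<union> (if p \<in> V then space (borel_of Z) - D else {})"
      using DC DZ V'(2) by (auto simp: f_def split: if_splits)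
    ultimately show "f -` V \<inter> space (borel_of Z) \<in> sets (borel_of Z)" by auto
  qed
  have "baire_property_in Z (f -` B \<inter> topspace Z)"
    by (rule universally_baire_in_preimage[OF B(1) Z f])
  then obtain V where V: "openin Z V" "meagre_in Z (sym_diff (f -` B \<inter> topspace Z) V)"
    unfolding baire_property_in_def by blast
  have fD: "f -` B \<inter> D = B \<inter> D" by (auto simp: f_def)
  show ?thesis
  proof (rule that[of "V \<inter> U"])
    show "openin Z (V \<inter> U)" using V(1) U(1) by (rule openin_Int)
    show "V \<inter> U \<noteq> {}"
    proof
      assume VU: "V \<inter> U = {}"
      have "B \<inter> D \<subseteq> sym_diff (f -` B \<inter> topspace Z) V"
        using VU fD DZ unfolding D_def by blast
      then show False using BD V(2) meagre_in_subset by blast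
    qed
    have "V \<inter> U - B \<subseteq> sym_diff (f -` B \<inter> topspace Z) V \<union> L"
      using fD U_top unfolding D_def by blast
    then show "meagre_in Z (V \<inter> U - B)"
      using meagre_in_Un[OF V(2) L] meagre_in_subset by blast
  qed
qed

context homeomorphism_action
begin

text \<open>If every class were meagre in the closure of the orbit of \<open>x\<close>, then \<open>F\<close> would be meagre in the
  square of that closure by the Kuratowski--Ulam theorem, and \<open>E0\<close> would embed into \<open>F\<close>. The class
  found need not be the one of \<open>x\<close>.\<close>

lemma smooth_nonmeagre_class:
  assumes X: "polish_topology Z" and x: "x \<in> topspace Z"
    and F: "superequivalence (topspace Z) (orbit_equiv G (topspace Z) \<phi>) F"
      "universally_baire_in (prod_topology Z Z) F" "smooth_equiv Z F"
  defines "Y \<equiv> subtopology Z (Z closure_of orbit G \<phi> x)"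
  obtains y where "y \<in> topspace Y" "\<not> meagre_in Y (F `` {y} \<inter> topspace Y)"
proof (rule ccontr)
  note nonmeagre = that
  assume "\<not> thesis"
  then have meagre: "meagre_in Y (F `` {y} \<inter> topspace Y)" if y: "y \<in> topspace Y" for y
    using nonmeagre[OF y] by blast
  let ?C = "Z closure_of orbit G \<phi> x"
  have CZ: "?C \<subseteq> topspace Z" by (rule closure_of_subset_topspace)
  have topY: "topspace Y = ?C" unfolding Y_def using CZ by auto
  have orb: "orbit G \<phi> x \<subseteq> ?C" using closure_of_subset[OF orbit_closed[OF x]] .
  have eq: "equiv (topspace Z) F" and orbF: "orbit_equiv G (topspace Z) \<phi> \<subseteq> F"
    using F(1) by (auto simp: superequivalence_def)
  have polY: "polish_topology Y"
    unfolding Y_def using X by (rule polish_topology_closedin) simp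
  have cmY: "completely_metrizable_space Y" using polY by (simp add: polish_topology_def)
  interpret Y: homeomorphism_action G Y \<phi>
    unfolding Y_def
    using CZ closure_of_orbit_invariant[OF x] by (rule restrict_to_invariant)
  define E where "E = F \<inter> topspace (prod_topology Y Y)"
  have "continuous_map (prod_topology Y Y) (prod_topology Z Z) id"
    by (subst subtopology_Times[symmetric, of Z ?C Z ?C, folded Y_def])
      (auto intro: continuous_map_from_subtopology)
  then have "id \<in> measurable (borel_of (prod_topology Y Y)) (borel_of (prod_topology Z Z))"
    by (rule continuous_map_borel_of)
  from universally_baire_in_preimage[OF F(2) polish_topology_prod[OF polY polY] this]
  have "baire_property_in (prod_topology Y Y) E" by (simp add: E_def)
  then have "meagre_in (prod_topology Y Y) E"
  proof (rule meagre_in_prod_of_sections[OF cmY cmY polish_second_countable[OF polY]])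
    fix y assume y: "y \<in> topspace Y"
    have "{z. (y, z) \<in> E} = F `` {y} \<inter> topspace Y" using y by (auto simp: E_def)
    then show "meagre_in Y {z. (y, z) \<in> E}" using meagre[OF y] by simp
  qed
  moreover have "sym E" using eq by (auto simp: E_def equiv_def sym_def)
  moreover have "Y closure_of orbit G \<phi> x = topspace Y"
    unfolding Y_def using orb by (simp add: closure_of_subtopology Int_absorb1 CZ)
  moreover have "x \<in> topspace Y" using orbit_self[OF x] orb topY by blast
  moreover have "(z, \<phi> g z) \<in> E" if "g \<in> carrier G" "z \<in> topspace Y" for g z
  proof -
    have "z \<in> topspace Z" using that(2) topY CZ by blast
    then have "(z, \<phi> g z) \<in> orbit_equiv G (topspace Z) \<phi>"
      using that(1) unfolding orbit_equiv_def orbit_def by blast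
    then show ?thesis using orbF Y.act_closed[OF that] that(2) unfolding E_def by auto
  qed
  ultimately obtain \<pi> where \<pi>: "continuous_map cantor_space Y \<pi>"
      "\<And>c d. (c, d) \<in> E0 \<longleftrightarrow> (\<pi> c, \<pi> d) \<in> E"
    using Y.E0_embeds_in_meagre[OF cmY, of x E] by metis
  have "\<pi> c \<in> topspace Y" for c
    using \<pi>(1) by (auto simp: continuous_map_def cantor_space_def)
  then have "(\<pi> c, \<pi> d) \<in> E \<longleftrightarrow> (\<pi> c, \<pi> d) \<in> F" for c d by (simp add: E_def)
  moreover have "\<pi> \<in> measurable (borel_of cantor_space) (borel_of Z)"
    using \<pi>(1) unfolding Y_def
    by (intro continuous_map_borel_of) (rule continuous_map_into_fulltopology)
  ultimately show False using F(3) \<pi>(2) unfolding smooth_equiv_def by blast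
qed

text \<open>The intersection of two translates of \<open>W\<close> is open. As the corresponding translates of \<open>B\<close> are
  disjoint, it lies in two translates of \<open>W - B\<close>, so it is meagre.\<close>

lemma wandering_openin:
  assumes Z: "completely_metrizable_space Z" and S: "S \<subseteq> carrier G" "wandering \<phi> S B"
    and W: "openin Z W" "meagre_in Z (W - B)"
  shows "wandering \<phi> S W"
  unfolding wandering_def
proof (intro ballI impI)
  fix g h assume gh: "g \<in> S" "h \<in> S" "g \<noteq> h"
  then have gh': "g \<in> carrier G" "h \<in> carrier G" using S(1) by auto
  have "meagre_in Z (\<phi> g ` (W - B) \<union> \<phi> h ` (W - B))"
    using gh' W(2) by (intro meagre_in_Un homeomorphic_map_meagre_in[OF homeomorphic])
  moreover have "\<phi> g ` B \<inter> \<phi> h ` B = {}" using S(2) gh unfolding wandering_def by blast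
  then have "\<phi> g ` W \<inter> \<phi> h ` W \<subseteq> \<phi> g ` (W - B) \<union> \<phi> h ` (W - B)" by blast
  ultimately have "meagre_in Z (\<phi> g ` W \<inter> \<phi> h ` W)" by (rule meagre_in_subset)
  then show "\<phi> g ` W \<inter> \<phi> h ` W = {}"
    using openin_image[OF gh'(1) W(1)] openin_image[OF gh'(2) W(1)]
    by (intro openin_meagre_in_empty[OF Z]) auto
qed

text \<open>Countably many translates of the wandering set cover a class that is not meagre in the closure
  of the orbit of \<open>x\<close>, so the wandering set is almost all of some open subset of that closure. Such an
  open set meets the orbit of \<open>x\<close>, even when \<open>x\<close> is not in the class.\<close>

lemma locally_wandering_open_set:
  assumes X: "polish_topology Z" and x: "x \<in> topspace Z"
    and F: "superequivalence (topspace Z) (orbit_equiv G (topspace Z) \<phi>) F"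
      "universally_baire_in (prod_topology Z Z) F" "smooth_equiv Z F"
    and S: "S \<subseteq> carrier G"
    and B: "\<And>y. y \<in> topspace Z \<Longrightarrow> \<exists>B. wandering \<phi> S B \<and> sigma_complete G (F `` {y}) \<phi> B \<and>
        universally_baire_in (subtopology Z (F `` {y})) B"
  obtains U where "openin Z U" "U \<inter> orbit G \<phi> x \<noteq> {}"
    "wandering \<phi> S (U \<inter> orbit G \<phi> x)"
proof -
  let ?C = "Z closure_of orbit G \<phi> x"
  define Y where "Y = subtopology Z ?C"
  have CZ: "?C \<subseteq> topspace Z" by (rule closure_of_subset_topspace)
  have topY: "topspace Y = ?C" unfolding Y_def using CZ by auto
  have polY: "polish_topology Y"
    unfolding Y_def using X by (rule polish_topology_closedin) simp
  interpret Y: homeomorphism_action G Y \<phi>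
    unfolding Y_def
    using CZ closure_of_orbit_invariant[OF x] by (rule restrict_to_invariant)
  obtain y where y: "y \<in> topspace Y" and nonmeagre: "\<not> meagre_in Y (F `` {y} \<inter> topspace Y)"
    using smooth_nonmeagre_class[OF X x F] unfolding Y_def by blast
  have yZ: "y \<in> topspace Z" using y topY CZ by blast
  obtain B where B: "wandering \<phi> S B" "sigma_complete G (F `` {y}) \<phi> B"
      "universally_baire_in (subtopology Z (F `` {y})) B"
    using B[OF yZ] by blast
  obtain H where H: "H \<subseteq> carrier G" "countable H" "F `` {y} = (\<Union>h\<in>H. \<phi> h ` B)"
    and BF: "B \<subseteq> F `` {y}"
    using B(2) unfolding sigma_complete_def by blast
  have FZ: "F `` {y} \<subseteq> topspace Z"
    using F(1) unfolding superequivalence_def equiv_def refl_on_def by blast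
  have "\<not> meagre_in Y (B \<inter> topspace Y)"
  proof
    assume "meagre_in Y (B \<inter> topspace Y)"
    then have "meagre_in Y (\<Union>h\<in>H. \<phi> h ` (B \<inter> topspace Y))"
      using H by (intro meagre_in_UN homeomorphic_map_meagre_in[OF Y.homeomorphic]) auto
    moreover have "F `` {y} \<inter> topspace Y \<subseteq> (\<Union>h\<in>H. \<phi> h ` (B \<inter> topspace Y))"
    proof
      fix z assume z: "z \<in> F `` {y} \<inter> topspace Y"
      then obtain h b where h: "h \<in> H" "b \<in> B" "z = \<phi> h b" using H(3) by blast
      have "b \<in> topspace Z" using h(2) BF FZ by blast
      then have "b = \<phi> (inv h) z" using h H(1) act_inv_act by auto
      then have "b \<in> topspace Y" using z h(1) H(1) Y.act_closed[of "inv h" z] by auto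
      then show "z \<in> (\<Union>h\<in>H. \<phi> h ` (B \<inter> topspace Y))" using h by blast
    qed
    ultimately show False using nonmeagre meagre_in_subset by blast
  qed
  moreover have "baire_property_in Y (F `` {y} \<inter> topspace Y)"
  proof -
    have "continuous_map Y (prod_topology Z Z) (\<lambda>z. (y, z))"
      unfolding Y_def using yZ
      by (intro continuous_map_from_subtopology) (simp add: continuous_map_pairwise o_def)
    from universally_baire_in_preimage[OF F(2) polY continuous_map_borel_of[OF this]]
    show ?thesis by (simp add: vimage_def Image_def)
  qed
  moreover have "subtopology Z (topspace Y) = Y" by (subst topY) (simp add: Y_def)
  ultimately obtain W where W: "openin Y W" "W \<noteq> {}" "meagre_in Y (W - B)"
    using nonmeagre_universally_baire_in_subspace[OF polY _ FZ _ B(3)] by blast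
  have "wandering \<phi> S W"
    using polY by (intro Y.wandering_openin[OF _ S B(1) W(1,3)]) (simp add: polish_topology_def)
  obtain U where U: "openin Z U" "W = U \<inter> ?C" using W(1) unfolding Y_def openin_subtopology by blast
  show ?thesis
  proof (rule that[of U])
    show "openin Z U" by (rule U(1))
    obtain w where "w \<in> U" "w \<in> ?C" using W(2) U(2) by blast
    then show "U \<inter> orbit G \<phi> x \<noteq> {}" using U(1) unfolding in_closure_of by blast
    have "U \<inter> orbit G \<phi> x \<subseteq> W" using U(2) closure_of_subset[OF orbit_closed[OF x]] by blast
    then show "wandering \<phi> S (U \<inter> orbit G \<phi> x)"
      using \<open>wandering \<phi> S W\<close> unfolding wandering_def by blast
  qed
qed

end


section \<open>Assembling a weakly wandering set\<close>

context homeomorphism_action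
begin

lemma orbit_subset_of_mem:
  assumes "x \<in> topspace Z" "y \<in> orbit G \<phi> x"
  shows "orbit G \<phi> y \<subseteq> orbit G \<phi> x"
proof
  fix z assume "z \<in> orbit G \<phi> y"
  then obtain g where "g \<in> carrier G" "z = \<phi> g y" unfolding orbit_def by blast
  then show "z \<in> orbit G \<phi> x" using act_orbit[OF assms(1) _ assms(2)] by simp
qed

lemma orbit_eq_of_mem:
  assumes "x \<in> topspace Z" "y \<in> orbit G \<phi> x"
  shows "orbit G \<phi> y = orbit G \<phi> x"
proof
  show "orbit G \<phi> y \<subseteq> orbit G \<phi> x" using assms by (rule orbit_subset_of_mem)
  obtain k where k: "k \<in> carrier G" "y = \<phi> k x" using assms(2) by (auto simp: orbit_def)
  have "x = \<phi> (inv k) y" using k assms(1) by (simp add: act_inv_act)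
  then have "x \<in> orbit G \<phi> y" using k(1) inv_closed unfolding orbit_def by blast
  moreover have "y \<in> topspace Z" using k assms(1) by (simp add: act_closed)
  ultimately show "orbit G \<phi> x \<subseteq> orbit G \<phi> y" by (intro orbit_subset_of_mem)
qed

definition saturation :: "'x set \<Rightarrow> 'x set" where
  "saturation U = {x \<in> topspace Z. U \<inter> orbit G \<phi> x \<noteq> {}}"

lemma openin_saturation:
  assumes "openin Z U"
  shows "openin Z (saturation U)"
proof -
  have "saturation U = (\<Union>g\<in>carrier G. {x \<in> topspace Z. \<phi> g x \<in> U})"
    unfolding saturation_def orbit_def by blast
  then show ?thesis
    using openin_continuous_map_preimage[OF continuous assms] by auto
qed

definition wandering_points :: "'a set \<Rightarrow> 'x set \<Rightarrow> 'x set" where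
  "wandering_points S U = {x \<in> saturation U. wandering \<phi> S (U \<inter> orbit G \<phi> x)}"

text \<open>An orbit is invariant, so translating \<open>U \<inter> orbit G \<phi> x\<close> amounts to translating \<open>U\<close>. For open \<open>U\<close>
  these points therefore form a difference of two open sets, which in a metrizable space is both
  \<open>F\<^sub>\<sigma>\<close> and \<open>G\<^sub>\<delta>\<close>.\<close>

lemma wandering_points_eq:
  assumes "S \<subseteq> carrier G" "U \<subseteq> topspace Z"
  shows "wandering_points S U =
    saturation U - (\<Union>(g, h)\<in>{p \<in> S \<times> S. fst p \<noteq> snd p}. saturation (\<phi> g ` U \<inter> \<phi> h ` U))"
proof -
  have img: "\<phi> g ` (U \<inter> orbit G \<phi> x) = \<phi> g ` U \<inter> orbit G \<phi> x"
    if x: "x \<in> topspace Z" and g: "g \<in> carrier G" for x g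
  proof -
    have "u \<in> orbit G \<phi> x" if u: "u \<in> U" "\<phi> g u \<in> orbit G \<phi> x" for u
    proof -
      have "\<phi> (inv g) (\<phi> g u) \<in> orbit G \<phi> x" using act_orbit[OF x inv_closed[OF g] u(2)] .
      moreover have "u \<in> topspace Z" using u(1) assms(2) by blast
      ultimately show ?thesis using act_inv_act[OF g] by simp
    qed
    then show ?thesis using act_orbit[OF x g] by blast
  qed
  have wand: "wandering \<phi> S (U \<inter> orbit G \<phi> x) \<longleftrightarrow>
      (\<forall>g\<in>S. \<forall>h\<in>S. g \<noteq> h \<longrightarrow> \<phi> g ` U \<inter> \<phi> h ` U \<inter> orbit G \<phi> x = {})"
    if x: "x \<in> topspace Z" for x
  proof -
    have "\<phi> g ` (U \<inter> orbit G \<phi> x) \<inter> \<phi> h ` (U \<inter> orbit G \<phi> x) = \<phi> g ` U \<inter> \<phi> h ` U \<inter> orbit G \<phi> x"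
      if "g \<in> S" "h \<in> S" for g h
      using img[OF x] that assms(1) by auto
    then show ?thesis unfolding wandering_def by simp
  qed
  show ?thesis (is "_ = saturation U - ?R")
  proof (rule Set.set_eqI)
    fix x
    have "x \<in> ?R \<longleftrightarrow> (\<exists>g\<in>S. \<exists>h\<in>S. g \<noteq> h \<and> x \<in> saturation (\<phi> g ` U \<inter> \<phi> h ` U))" by auto
    moreover have "x \<in> saturation (\<phi> g ` U \<inter> \<phi> h ` U) \<longleftrightarrow> \<phi> g ` U \<inter> \<phi> h ` U \<inter> orbit G \<phi> x \<noteq> {}"
      if "x \<in> topspace Z" for g h
      using that by (simp add: saturation_def)
    ultimately have "x \<notin> ?R \<longleftrightarrow> wandering \<phi> S (U \<inter> orbit G \<phi> x)" if "x \<in> topspace Z"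
      using that wand[of x] by (simp add: imp_conv_disj)
    then show "x \<in> wandering_points S U \<longleftrightarrow> x \<in> saturation U - ?R"
      unfolding wandering_points_def saturation_def[of U] by blast
  qed
qed

lemma wandering_points_act:
  assumes "x \<in> wandering_points S U" "y \<in> orbit G \<phi> x"
  shows "y \<in> wandering_points S U"
proof -
  have x: "x \<in> topspace Z" using assms(1) by (simp add: wandering_points_def saturation_def)
  have "y \<in> topspace Z" using assms(2) orbit_closed[OF x] by blast
  then show ?thesis
    using assms orbit_eq_of_mem[OF x assms(2)] by (simp add: wandering_points_def saturation_def)
qed

text \<open>The points for which a given basic open set works form an invariant set. Sending each point to
  the first basic open set that works for it therefore splits the space into invariant pieces, and
  the union of the \<open>n\<close>-th basic open set intersected with the \<open>n\<close>-th piece is wandering: two of its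
  points with a common translate lie in one orbit, hence in one piece. The relatively open part of
  every orbit is recorded because covering the orbit by countably many translates depends on it.\<close>

lemma fsigma_weakly_wandering:
  assumes X: "metrizable_space Z" "second_countable Z" and S: "S \<subseteq> carrier G"
    and loc: "\<And>x. x \<in> topspace Z \<Longrightarrow>
      \<exists>U. openin Z U \<and> U \<inter> orbit G \<phi> x \<noteq> {} \<and> wandering \<phi> S (U \<inter> orbit G \<phi> x)"
  obtains Y where "fsigma_in Z Y" "wandering \<phi> S Y"
    "\<And>x. x \<in> topspace Z \<Longrightarrow>
      \<exists>U. openin Z U \<and> U \<inter> orbit G \<phi> x \<noteq> {} \<and> U \<inter> orbit G \<phi> x \<subseteq> Y"
proof -
  obtain \<B> where \<B>: "countable \<B>" "\<And>V. V \<in> \<B> \<Longrightarrow> openin Z V"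
      "\<forall>W y. openin Z W \<and> y \<in> W \<longrightarrow> (\<exists>V\<in>\<B>. y \<in> V \<and> V \<subseteq> W)"
    using X(2) by (auto simp: second_countable_def)
  define \<B>' where "\<B>' = insert {} \<B>"
  have \<B>': "countable \<B>'" "\<B>' \<noteq> {}" "\<And>V. V \<in> \<B>' \<Longrightarrow> openin Z V"
    using \<B> by (auto simp: \<B>'_def)
  define U where "U = from_nat_into \<B>'"
  have U: "openin Z (U n)" for n using \<B>'(3) from_nat_into[OF \<B>'(2)] by (simp add: U_def)
  have U_top: "U n \<subseteq> topspace Z" for n by (rule openin_subset[OF U])
  define P where "P n = wandering_points S (U n)" for n
  define Y where "Y = (\<Union>n. U n \<inter> (P n - (\<Union>m<n. P m)))"
  have P_orbit: "y \<in> P n \<longleftrightarrow> x \<in> P n" if x: "x \<in> topspace Z" "y \<in> orbit G \<phi> x" for x y n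
  proof
    have y: "y \<in> topspace Z" using x orbit_closed by blast
    have "x \<in> orbit G \<phi> y" using orbit_eq_of_mem[OF x] orbit_self[OF x(1)] by simp
    then show "y \<in> P n \<Longrightarrow> x \<in> P n" unfolding P_def using wandering_points_act by blast
    show "x \<in> P n \<Longrightarrow> y \<in> P n" unfolding P_def using wandering_points_act x(2) by blast
  qed
  have gd: "gdelta_in Z (P n)" and fs: "fsigma_in Z (P n)" for n
  proof -
    have op: "openin Z (\<Union>(g, h)\<in>{p \<in> S \<times> S. fst p \<noteq> snd p}. saturation (\<phi> g ` U n \<inter> \<phi> h ` U n))"
      using S U by (auto intro!: openin_saturation openin_Int openin_image)
    have sat: "openin Z (saturation (U n))" using U by (rule openin_saturation)
    show "gdelta_in Z (P n)"
      unfolding P_def wandering_points_eq[OF S U_top]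
      using sat op X(1) by (intro gdelta_in_diff open_imp_gdelta_in open_imp_fsigma_in)
    show "fsigma_in Z (P n)"
      unfolding P_def wandering_points_eq[OF S U_top]
      using sat op X(1) by (intro fsigma_in_diff open_imp_gdelta_in open_imp_fsigma_in)
  qed
  have gd': "gdelta_in Z (\<Union>m<n. P m)" for n
    by (induction n) (auto simp: lessThan_Suc intro: gdelta_in_Un gd)
  have "fsigma_in Z (U n \<inter> (P n - (\<Union>m<n. P m)))" for n
    by (intro fsigma_in_Int fsigma_in_diff fs gd' open_imp_fsigma_in X(1) U)
  then have "fsigma_in Z Y" unfolding Y_def by (intro fsigma_in_Union) auto
  moreover have "wandering \<phi> S Y"
    unfolding wandering_def
  proof (intro ballI impI equals0I)
    fix g h z assume gh: "g \<in> S" "h \<in> S" "g \<noteq> h" and z: "z \<in> \<phi> g ` Y \<inter> \<phi> h ` Y"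
    have gh': "g \<in> carrier G" "h \<in> carrier G" using gh S by auto
    obtain a b where a: "a \<in> Y" "z = \<phi> g a" and b: "b \<in> Y" "z = \<phi> h b" using z by blast
    obtain m where m: "a \<in> U m" "a \<in> P m" "\<And>i. i < m \<Longrightarrow> a \<notin> P i" using a(1) unfolding Y_def by blast
    obtain n where n: "b \<in> U n" "b \<in> P n" "\<And>i. i < n \<Longrightarrow> b \<notin> P i" using b(1) unfolding Y_def by blast
    have aZ: "a \<in> topspace Z" and bZ: "b \<in> topspace Z" using m(1) n(1) U_top by auto
    have za: "z \<in> orbit G \<phi> a" and zb: "z \<in> orbit G \<phi> b"
      using a(2) b(2) gh' unfolding orbit_def by blast+
    have zP: "z \<in> P i \<longleftrightarrow> a \<in> P i" "z \<in> P i \<longleftrightarrow> b \<in> P i" for i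
      using P_orbit[OF aZ za] P_orbit[OF bZ zb] by auto
    have "m = n"
      using m n zP by (metis linorder_neqE_nat)
    moreover have "orbit G \<phi> a = orbit G \<phi> b"
      using orbit_eq_of_mem[OF aZ za] orbit_eq_of_mem[OF bZ zb] by simp
    ultimately have "a \<in> U m \<inter> orbit G \<phi> a" "b \<in> U m \<inter> orbit G \<phi> a"
      using m(1) n(1) orbit_self[OF aZ] orbit_self[OF bZ] by auto
    then have "z \<in> \<phi> g ` (U m \<inter> orbit G \<phi> a) \<inter> \<phi> h ` (U m \<inter> orbit G \<phi> a)"
      using a(2) b(2) by blast
    moreover have "wandering \<phi> S (U m \<inter> orbit G \<phi> a)"
      using m(2) by (simp add: P_def wandering_points_def)
    ultimately show False using gh unfolding wandering_def by blast
  qed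
  moreover have "\<exists>U. openin Z U \<and> U \<inter> orbit G \<phi> x \<noteq> {} \<and> U \<inter> orbit G \<phi> x \<subseteq> Y"
    if x: "x \<in> topspace Z" for x
  proof -
    obtain V where V: "openin Z V" "V \<inter> orbit G \<phi> x \<noteq> {}" "wandering \<phi> S (V \<inter> orbit G \<phi> x)"
      using loc[OF x] by blast
    then obtain w where w: "w \<in> V" "w \<in> orbit G \<phi> x" by blast
    then obtain B where B: "B \<in> \<B>" "w \<in> B" "B \<subseteq> V" using \<B>(3) V(1) by blast
    have "B \<in> \<B>'" using B(1) by (simp add: \<B>'_def)
    then obtain n where "U n = B" unfolding U_def using from_nat_into_surj[OF \<B>'(1)] by metis
    moreover have "wandering \<phi> S (B \<inter> orbit G \<phi> x)"
      using V(3) B(3) unfolding wandering_def by blast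
    ultimately have "x \<in> P n"
      using x w(2) B(2) unfolding P_def wandering_points_def saturation_def by blast
    define k where "k = (LEAST n. x \<in> P n)"
    have k: "x \<in> P k" "\<And>i. i < k \<Longrightarrow> x \<notin> P i"
      using LeastI[of "\<lambda>n. x \<in> P n", OF \<open>x \<in> P n\<close>] not_less_Least unfolding k_def by auto
    have "U k \<inter> orbit G \<phi> x \<subseteq> Y"
      using k P_orbit[OF x] unfolding Y_def by blast
    moreover have "U k \<inter> orbit G \<phi> x \<noteq> {}"
      using k(1) unfolding P_def wandering_points_def saturation_def by blast
    ultimately show ?thesis using U by blast
  qed
  ultimately show ?thesis by (rule that)
qed

end

text \<open>The elements \<open>g\<close> for which \<open>x\<close> lies in \<open>\<phi> g ` U\<close> form a nonempty open set, which \<open>H\<close> meets.\<close>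

lemma orbit_covered_by_dense_translates:
  assumes G: "topological_group G T" and act: "continuous_action G T X \<phi>"
    and H: "H \<subseteq> carrier G" "T closure_of H = topspace T"
    and x: "x \<in> topspace X" and U: "openin X U" "U \<inter> orbit G \<phi> x \<noteq> {}"
  shows "\<exists>h\<in>H. \<exists>u\<in>U \<inter> orbit G \<phi> x. x = \<phi> h u"
proof -
  interpret homeomorphism_action G X \<phi>
    using G act by (rule continuous_action_imp_homeomorphism_action)
  have T: "topspace T = carrier G" using G by (simp add: topological_group_def)
  have inv: "continuous_map T T (\<lambda>g. inv\<^bsub>G\<^esub> g)" using G by (simp add: topological_group_def)
  have "continuous_map T (prod_topology T X) (\<lambda>g. (inv\<^bsub>G\<^esub> g, x))"
    using inv x by (simp add: continuous_map_pairwise o_def)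
  from continuous_map_compose[OF this, of X "\<lambda>(g, x). \<phi> g x"]
  have "continuous_map T X (\<lambda>g. \<phi> (inv\<^bsub>G\<^esub> g) x)"
    using act by (simp add: continuous_action_def o_def)
  then have "openin T {g \<in> topspace T. \<phi> (inv\<^bsub>G\<^esub> g) x \<in> U}"
    using U(1) by (rule openin_continuous_map_preimage)
  moreover obtain k where "k \<in> carrier G" "\<phi> k x \<in> U" using U(2) by (auto simp: orbit_def)
  then have "inv\<^bsub>G\<^esub> k \<in> {g \<in> topspace T. \<phi> (inv\<^bsub>G\<^esub> g) x \<in> U}" using T by simp
  ultimately obtain h where h: "h \<in> H" "\<phi> (inv\<^bsub>G\<^esub> h) x \<in> U"
    using H(2) unfolding dense_intersects_open by blast
  have "h \<in> carrier G" using h(1) H(1) by blast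
  then have "\<phi> (inv\<^bsub>G\<^esub> h) x \<in> orbit G \<phi> x" "x = \<phi> h (\<phi> (inv\<^bsub>G\<^esub> h) x)"
    using x by (auto simp: orbit_def act_act_inv)
  then show ?thesis using h by blast
qed


section \<open>The equivalence\<close>

text \<open>The equation \<open>\<phi> g b = \<phi> h b'\<close> says that \<open>inv g \<otimes> h\<close> carries \<open>b'\<close> to \<open>b\<close>.\<close>

lemma (in homeomorphism_action) wandering_iff_return_set:
  assumes S: "S \<subseteq> carrier G" and B: "B \<subseteq> topspace Z"
  shows "wandering \<phi> S B \<longleftrightarrow>
    (((set_inv S) <#> S) - {\<one>}) \<inter> return_set G \<phi> B = {}"
proof -
  have quot: "B \<inter> \<phi> (inv g \<otimes> h) ` B \<noteq> {} \<longleftrightarrow> \<phi> g ` B \<inter> \<phi> h ` B \<noteq> {}"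
    if "g \<in> S" "h \<in> S" for g h
  proof -
    have gh: "g \<in> carrier G" "h \<in> carrier G" using that S by auto
    have "b = \<phi> (inv g \<otimes> h) b' \<longleftrightarrow> \<phi> g b = \<phi> h b'" if "b \<in> B" "b' \<in> B" for b b'
    proof -
      have bZ: "b \<in> topspace Z" "b' \<in> topspace Z" using that B by auto
      have "\<phi> (inv g \<otimes> h) b' = \<phi> (inv g) (\<phi> h b')" using gh bZ by (simp add: act_mult)
      moreover have "\<phi> g (\<phi> (inv g) (\<phi> h b')) = \<phi> h b'"
        using gh bZ by (simp add: act_act_inv act_closed)
      moreover have "\<phi> (inv g) (\<phi> g b) = b" using gh bZ by (simp add: act_inv_act)
      ultimately show ?thesis by metis
    qed
    then show ?thesis by blast
  qed
  have one: "inv g \<otimes> h = \<one> \<longleftrightarrow> g = h" if "g \<in> S" "h \<in> S" for g h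
    using that S by (metis inv_closed inv_inv inv_equality l_inv subsetD)
  have prod: "(set_inv S) <#> S = {inv g \<otimes> h | g h. g \<in> S \<and> h \<in> S}"
    by (auto simp: set_mult_def SET_INV_def)
  have mem: "inv g \<otimes> h \<in> ((set_inv S <#> S) - {\<one>}) \<inter> return_set G \<phi> B \<longleftrightarrow>
      g \<noteq> h \<and> \<phi> g ` B \<inter> \<phi> h ` B \<noteq> {}" if gh: "g \<in> S" "h \<in> S" for g h
  proof -
    have "inv g \<otimes> h \<in> carrier G" using gh S by auto
    moreover have "inv g \<otimes> h \<in> set_inv S <#> S" unfolding prod using gh by blast
    ultimately show ?thesis using quot[OF gh] one[OF gh] by (simp add: return_set_def)
  qed
  have elem: "(\<forall>k\<in>set_inv S <#> S. P k) \<longleftrightarrow> (\<forall>g\<in>S. \<forall>h\<in>S. P (inv g \<otimes> h))" for P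
    unfolding prod by blast
  have "((set_inv S <#> S) - {\<one>}) \<inter> return_set G \<phi> B = {} \<longleftrightarrow>
      (\<forall>k\<in>set_inv S <#> S. k \<notin> ((set_inv S <#> S) - {\<one>}) \<inter> return_set G \<phi> B)"
    by blast
  also have "\<dots> \<longleftrightarrow>
      (\<forall>g\<in>S. \<forall>h\<in>S. inv g \<otimes> h \<notin> ((set_inv S <#> S) - {\<one>}) \<inter> return_set G \<phi> B)"
    by (rule elem)
  also have "\<dots> \<longleftrightarrow> (\<forall>g\<in>S. \<forall>h\<in>S. \<not> (g \<noteq> h \<and> \<phi> g ` B \<inter> \<phi> h ` B \<noteq> {}))"
    using mem by meson
  also have "\<dots> \<longleftrightarrow> wandering \<phi> S B" unfolding wandering_def by blast
  finally show ?thesis by blast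
qed

text \<open>The sets on which recurrence for \<open>S\<^sup>-\<^sup>1S - {1}\<close> fails are the \<open>S\<close>-wandering ones, so leaving the
  spectrum is the Borel form of having an \<open>S\<close>-wandering \<open>\<sigma>\<close>-complete set in every class.\<close>

lemma not_in_recurrence_spectrum_iff:
  assumes act: "homeomorphism_action G X \<phi>" and S: "S \<subseteq> carrier G"
  shows "meeting_family G (((set_inv\<^bsub>G\<^esub> S) <#>\<^bsub>G\<^esub> S) - {\<one>\<^bsub>G\<^esub>}) \<notin> recurrence_spectrum G X \<phi> \<longleftrightarrow>
    (\<exists>F. superequivalence (topspace X) (orbit_equiv G (topspace X) \<phi>) F \<and>
         F \<in> sets (borel_of (prod_topology X X)) \<and> smooth_equiv X F \<and>
         (\<forall>x \<in> topspace X. \<exists>B. wandering \<phi> S B \<and> sigma_complete G (F `` {x}) \<phi> B \<and>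
            B \<in> sets (borel_of (subtopology X (F `` {x})))))"
proof -
  interpret homeomorphism_action G X \<phi> by (rule act)
  let ?Q = "((set_inv\<^bsub>G\<^esub> S) <#>\<^bsub>G\<^esub> S) - {\<one>\<^bsub>G\<^esub>}"
  have "upward_closed_family G (meeting_family G ?Q)"
    unfolding upward_closed_family_def meeting_family_def by auto
  moreover have "\<not> recurrent_on G \<phi> (meeting_family G ?Q)
      {B \<in> sets (borel_of (subtopology X C)). sigma_complete G C \<phi> B} \<longleftrightarrow>
      (\<exists>B. wandering \<phi> S B \<and> sigma_complete G C \<phi> B \<and> B \<in> sets (borel_of (subtopology X C)))"
    (is "?L C \<longleftrightarrow> ?R C") for C
  proof -
    have "return_set G \<phi> B \<notin> meeting_family G ?Q \<longleftrightarrow> wandering \<phi> S B"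
      if "B \<in> sets (borel_of (subtopology X C))" for B
    proof -
      have "B \<subseteq> topspace X" using sets.sets_into_space[OF that] by simp
      moreover have "return_set G \<phi> B \<subseteq> carrier G" by (auto simp: return_set_def)
      ultimately show ?thesis
        using wandering_iff_return_set[OF S, of B] by (simp add: meeting_family_def)
    qed
    then show ?thesis unfolding recurrent_on_def by blast
  qed
  moreover have "(\<forall>C\<in>topspace X // F. ?R C) \<longleftrightarrow> (\<forall>x\<in>topspace X. ?R (F `` {x}))" for F
    unfolding quotient_def by blast
  ultimately show ?thesis unfolding recurrence_spectrum_def by (simp; blast)
qed

lemma trivial_relation_smooth: "smooth_equiv X (topspace X \<times> topspace X)"
  unfolding smooth_equiv_def
proof (rule notI, elim bexE)
  fix \<pi> assume \<pi>: "\<pi> \<in> measurable (borel_of cantor_space) (borel_of X)"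
    and iff: "\<forall>c d. (c, d) \<in> E0 \<longleftrightarrow> (\<pi> c, \<pi> d) \<in> topspace X \<times> topspace X"
  have "\<pi> c \<in> topspace X" for c
    using measurable_space[OF \<pi>, of c] by (simp add: cantor_space_def)
  then have "((\<lambda>_. False), (\<lambda>_. True)) \<in> E0" using iff by blast
  then show False by (auto simp: E0_def)
qed


theorem proposition3p3:
  fixes G :: "('g, 'm) monoid_scheme"
    and T :: "'g topology"
    and X :: "'x topology"
    and \<phi> :: "'g \<Rightarrow> 'x \<Rightarrow> 'x"
  assumes "topological_group G T" and "separable_space T"
    and "polish_topology X"
    and "continuous_action G T X \<phi>"
  shows
    "((\<exists>S \<in> quotient_sets G. meeting_family G S \<notin> recurrence_spectrum G X \<phi>)
      \<longleftrightarrow>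
      (\<exists>S F. S \<subseteq> carrier G \<and> infinite S \<and>
         superequivalence (topspace X) (orbit_equiv G (topspace X) \<phi>) F \<and>
         universally_baire_in (prod_topology X X) F \<and> smooth_equiv X F \<and>
         (\<forall>x \<in> topspace X. \<exists>Y.
            wandering \<phi> S Y \<and> sigma_complete G (F `` {x}) \<phi> Y \<and>
            universally_baire_in (subtopology X (F `` {x})) Y)))
     \<and>
     ((\<exists>S F. S \<subseteq> carrier G \<and> infinite S \<and>
         superequivalence (topspace X) (orbit_equiv G (topspace X) \<phi>) F \<and>
         universally_baire_in (prod_topology X X) F \<and> smooth_equiv X F \<and>
         (\<forall>x \<in> topspace X. \<exists>Y.
            wandering \<phi> S Y \<and> sigma_complete G (F `` {x}) \<phi> Y \<and>
            universally_baire_in (subtopology X (F `` {x})) Y))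
      \<longleftrightarrow>
      (\<exists>Y. weakly_wandering G \<phi> Y \<and> sigma_complete G (topspace X) \<phi> Y \<and> fsigma_in X Y))"
    (is "(?recurrence \<longleftrightarrow> ?classwise) \<and> (_ \<longleftrightarrow> ?fsigma)")
proof -
  have act: "homeomorphism_action G X \<phi>"
    using assms(1,4) by (rule continuous_action_imp_homeomorphism_action)
  interpret homeomorphism_action G X \<phi> by (rule act)
  have recurrence: "?recurrence \<longleftrightarrow> (\<exists>S F. S \<subseteq> carrier G \<and> infinite S \<and>
      superequivalence (topspace X) (orbit_equiv G (topspace X) \<phi>) F \<and>
      F \<in> sets (borel_of (prod_topology X X)) \<and> smooth_equiv X F \<and>
      (\<forall>x \<in> topspace X. \<exists>B. wandering \<phi> S B \<and> sigma_complete G (F `` {x}) \<phi> B \<and>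
         B \<in> sets (borel_of (subtopology X (F `` {x})))))"
    (is "_ \<longleftrightarrow> ?borel")
  proof -
    have "?recurrence \<longleftrightarrow> (\<exists>S. S \<subseteq> carrier G \<and> infinite S \<and>
        meeting_family G (((set_inv\<^bsub>G\<^esub> S) <#>\<^bsub>G\<^esub> S) - {\<one>\<^bsub>G\<^esub>}) \<notin> recurrence_spectrum G X \<phi>)"
      unfolding quotient_sets_def by blast
    then show ?thesis
      by (simp add: not_in_recurrence_spectrum_iff[OF act] cong: conj_cong)
  qed
  have "?recurrence \<Longrightarrow> ?classwise"
    unfolding recurrence using borel_imp_universally_baire_in by meson
  moreover have "?fsigma" if ?classwise
  proof -
    obtain S F where S: "S \<subseteq> carrier G" "infinite S"
      and F: "superequivalence (topspace X) (orbit_equiv G (topspace X) \<phi>) F"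
        "universally_baire_in (prod_topology X X) F" "smooth_equiv X F"
      and B: "\<forall>x \<in> topspace X. \<exists>Y. wandering \<phi> S Y \<and> sigma_complete G (F `` {x}) \<phi> Y \<and>
          universally_baire_in (subtopology X (F `` {x})) Y"
      using \<open>?classwise\<close> by (elim exE conjE) (rule that)
    have loc: "\<exists>U. openin X U \<and> U \<inter> orbit G \<phi> x \<noteq> {} \<and> wandering \<phi> S (U \<inter> orbit G \<phi> x)"
      if "x \<in> topspace X" for x
      by (rule locally_wandering_open_set[OF assms(3) that F S(1) bspec[OF B]]) blast+
    have "metrizable_space X"
      using assms(3) by (simp add: polish_topology_def completely_metrizable_imp_metrizable_space)
    then obtain Y where Y: "fsigma_in X Y" "wandering \<phi> S Y"
        "\<And>x. x \<in> topspace X \<Longrightarrow>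
          \<exists>U. openin X U \<and> U \<inter> orbit G \<phi> x \<noteq> {} \<and> U \<inter> orbit G \<phi> x \<subseteq> Y"
      using fsigma_weakly_wandering[OF _ polish_second_countable[OF assms(3)] S(1) loc] by metis
    obtain H where H: "countable H" "H \<subseteq> topspace T" "T closure_of H = topspace T"
      using assms(2) by (auto simp: separable_space_def)
    have HG: "H \<subseteq> carrier G" using H(2) assms(1) by (simp add: topological_group_def)
    have YX: "Y \<subseteq> topspace X" using Y(1) by (rule fsigma_in_subset)
    have "topspace X = (\<Union>h\<in>H. \<phi> h ` Y)"
    proof
      show "topspace X \<subseteq> (\<Union>h\<in>H. \<phi> h ` Y)"
      proof
        fix x assume x: "x \<in> topspace X"
        then obtain U where U: "openin X U" "U \<inter> orbit G \<phi> x \<noteq> {}" "U \<inter> orbit G \<phi> x \<subseteq> Y"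
          using Y(3) by blast
        show "x \<in> (\<Union>h\<in>H. \<phi> h ` Y)"
          using orbit_covered_by_dense_translates[OF assms(1,4) HG H(3) x U(1,2)] U(3) by blast
      qed
      show "(\<Union>h\<in>H. \<phi> h ` Y) \<subseteq> topspace X" using HG YX act_closed by blast
    qed
    then have "sigma_complete G (topspace X) \<phi> Y"
      unfolding sigma_complete_def using YX HG H(1) by blast
    moreover have "weakly_wandering G \<phi> Y"
      unfolding weakly_wandering_def using S Y(2) by blast
    ultimately show ?fsigma using Y(1) by blast
  qed
  moreover have "?recurrence" if ?fsigma
  proof -
    obtain Y S where Y: "sigma_complete G (topspace X) \<phi> Y" "fsigma_in X Y"
      and S: "S \<subseteq> carrier G" "infinite S" "wandering \<phi> S Y"
      using \<open>?fsigma\<close> unfolding weakly_wandering_def by blast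
    \<comment> \<open>Every class of the coarsest relation is the whole space, where \<open>Y\<close> is the witness.\<close>
    let ?F = "topspace X \<times> topspace X"
    have "superequivalence (topspace X) (orbit_equiv G (topspace X) \<phi>) ?F"
      unfolding superequivalence_def orbit_equiv_def using orbit_closed
      by (auto intro!: equivI refl_onI symI transI)
    moreover have "?F \<in> sets (borel_of (prod_topology X X))"
      using sets.top[of "borel_of (prod_topology X X)"] by simp
    moreover have "Y \<in> sets (borel_of X)" using Y(2) by (rule fsigma_in_borel_of)
    then have "Y \<in> sets (borel_of (subtopology X (?F `` {x})))" if "x \<in> topspace X" for x
      using that by (simp add: Image_def)
    moreover have "sigma_complete G (?F `` {x}) \<phi> Y" if "x \<in> topspace X" for x
      using that Y(1) by (simp add: Image_def)
    ultimately show ?recurrence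
      unfolding recurrence using S trivial_relation_smooth by blast
  qed
  ultimately show ?thesis by blast
qed

end
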